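(* Let $C$ be the category of finite groups. Let $(M_G)_G$ be a tuple of real numbers indexed by the isomorphism classes of finite groups. If $M_G=O(|G|^n)$ for some real $n$, then $(M_G)_G$ is well-behaved.
   Context: $M_G=O(|G|^n)$ means there is a constant $c$ with $|M_G|\le c|G|^n$ for all finite groups $G$. A level in the category of finite groups is a set of isomorphism classes of finite groups of the form: the smallest set containing a given finite set of finite groups and the trivial group, closed under quotients and finite subdirect products. $\mathrm{Epi}(G,F)$ is the set of surjective homomorphisms $G\to F$. For a surjection $\pi:G\to F$ of finite groups, the quotients of $G$ (up to isomorphism under $G$) through which $\pi$ factors form a finite lattice $[F,G]$, where $H\ge H'$ if $G\to H'$ factors through $G\to H$; $\mu(\pi)$ is the value of its M\"obius function from the minimum $F$ to the maximum $G$; $Z(\pi)$ is the number of $H\in[F,G]$ with $H\vee(K_1\wedge K_2)=(H\vee K_1)\wedge(H\vee K_2)$ for all $K_1,K_2\in[F,G]$. The tuple $(M_G)_G$ is well-behaved if for every level $\mathcal{L}$ and every $F\in\mathcal{L}$, $\sum_{G\in\mathcal{L}}\sum_{\pi\in\mathrm{Epi}(G,F)}\frac{|\mu(\pi)|}{|\mathrm{Aut}(G)|}Z(\pi)^3|M_G|<\infty$ (sum over isomorphism classes $G$). *)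

theory Defs
  imports "HOL-Algebra.Algebra" "HOL-Analysis.Infinite_Sum"
begin

section \<open>Isomorphism classes and levels\<close>

definition finite_group :: "('a, 'b) monoid_scheme \<Rightarrow> bool" where
  "finite_group G \<longleftrightarrow> group G \<and> finite (carrier G)"

text \<open>Every finite group is isomorphic to one whose elements are natural numbers, so the
  isomorphism class of a finite group (over any type) is recorded by its members over
  \<^typ>\<open>nat\<close>.\<close>

definition iso_class :: "('a, 'b) monoid_scheme \<Rightarrow> nat monoid set" where
  "iso_class G = {H. finite_group H \<and> H \<cong> G}"

definition iso_classes :: "nat monoid set set" where
  "iso_classes = {iso_class G | G :: nat monoid. finite_group G}"

definition representative :: "nat monoid set \<Rightarrow> nat monoid" where
  "representative \<C> = (SOME G. G \<in> \<C>)"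

definition subdirect_product ::
    "'i set \<Rightarrow> ('i \<Rightarrow> ('a, 'b) monoid_scheme) \<Rightarrow> ('i \<Rightarrow> 'a) set \<Rightarrow> bool" where
  "subdirect_product I H P \<longleftrightarrow>
     subgroup P (product_group I H) \<and> (\<forall>i\<in>I. (\<lambda>x. x i) ` P = carrier (H i))"

inductive_set generated_level :: "nat monoid set set \<Rightarrow> nat monoid set set"
  for S :: "nat monoid set set" where
  generator: "\<C> \<in> S \<Longrightarrow> \<C> \<in> generated_level S"
| trivial: "iso_class (singleton_group (0::nat)) \<in> generated_level S"
| quotient: "\<lbrakk>finite_group (G :: nat monoid); iso_class G \<in> generated_level S; N \<lhd> G\<rbrakk>
    \<Longrightarrow> iso_class (G Mod N) \<in> generated_level S"
| subdirect: "\<lbrakk>finite (I :: nat set);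
      \<And>i. i \<in> I \<Longrightarrow> finite_group (H i :: nat monoid);
      \<And>i. i \<in> I \<Longrightarrow> iso_class (H i) \<in> generated_level S;
      subdirect_product I H P\<rbrakk>
    \<Longrightarrow> iso_class ((product_group I H)\<lparr>carrier := P\<rparr>) \<in> generated_level S"

definition is_level :: "nat monoid set set \<Rightarrow> bool" where
  "is_level \<L> \<longleftrightarrow> (\<exists>S. finite S \<and> S \<subseteq> iso_classes \<and> \<L> = generated_level S)"


section \<open>The lattice of intermediate quotients\<close>

text \<open>\<open>r\<close> from \<open>G\<close> to \<open>K\<close> factors through \<open>q\<close> from \<open>G\<close> to \<open>H\<close>.\<close>

definition factors_through ::
    "('g, 'x) monoid_scheme \<Rightarrow> ('g \<Rightarrow> 'h) \<Rightarrow> ('h, 'y) monoid_scheme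
      \<Rightarrow> ('g \<Rightarrow> 'k) \<Rightarrow> ('k, 'z) monoid_scheme \<Rightarrow> bool" where
  "factors_through G q H r K \<longleftrightarrow> (\<exists>g\<in>hom H K. \<forall>x\<in>carrier G. r x = g (q x))"

text \<open>Each quotient of \<open>G\<close> is, up to isomorphism under \<open>G\<close>, the coset map
  \<open>G \<rightarrow> G Mod N\<close> for exactly one normal subgroup \<open>N\<close> (lemma \<open>quotient_unique_Mod\<close> below);
  this \<open>N\<close> is used as the name of the quotient. The minimum \<open>F\<close> is therefore named by
  \<open>kernel G F \<pi>\<close> and the maximum \<open>G\<close> by the trivial subgroup.\<close>

definition quotient_lattice ::
    "('a, 'x) monoid_scheme \<Rightarrow> ('b, 'y) monoid_scheme \<Rightarrow> ('a \<Rightarrow> 'b) \<Rightarrow> 'a set gorder" where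
  "quotient_lattice G F \<pi> =
     \<lparr>carrier = {N. N \<lhd> G \<and> factors_through G (\<lambda>x. N #>\<^bsub>G\<^esub> x) (G Mod N) \<pi> F},
      eq = (=),
      le = (\<lambda>N' N. factors_through G (\<lambda>x. N #>\<^bsub>G\<^esub> x) (G Mod N)
                                     (\<lambda>x. N' #>\<^bsub>G\<^esub> x) (G Mod N'))\<rparr>"

text \<open>The guard makes the recursion terminate; it holds for the lattices used here by
  lemmas \<open>finite_quotient_lattice\<close> and \<open>lattice_quotient_lattice\<close>.\<close>

function moebius :: "'a gorder \<Rightarrow> 'a \<Rightarrow> 'a \<Rightarrow> int" where
  "moebius L x y =
     (if partial_order L \<and> finite (carrier L) \<and> x \<in> carrier L \<and> y \<in> carrier L \<and> x \<sqsubseteq>\<^bsub>L\<^esub> y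
      then (if x = y then 1
            else - (\<Sum>z\<in>{z \<in> carrier L. x \<sqsubseteq>\<^bsub>L\<^esub> z \<and> z \<sqsubseteq>\<^bsub>L\<^esub> y \<and> z \<noteq> y}. moebius L x z))
      else 0)"
  by pat_completeness auto
termination
proof (relation "measure (\<lambda>(L, x, y). card {w \<in> carrier L. x \<sqsubseteq>\<^bsub>L\<^esub> w \<and> w \<sqsubseteq>\<^bsub>L\<^esub> y})")
  fix L :: "'a gorder" and x y z
  assume L: "partial_order L \<and> finite (carrier L) \<and> x \<in> carrier L \<and> y \<in> carrier L \<and> x \<sqsubseteq>\<^bsub>L\<^esub> y"
    and z: "z \<in> {z \<in> carrier L. x \<sqsubseteq>\<^bsub>L\<^esub> z \<and> z \<sqsubseteq>\<^bsub>L\<^esub> y \<and> z \<noteq> y}"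
  interpret partial_order L using L by simp
  have "w \<sqsubseteq>\<^bsub>L\<^esub> y" if "w \<in> carrier L" "w \<sqsubseteq>\<^bsub>L\<^esub> z" for w
    using le_trans[OF that(2)] that(1) L z by simp
  then have "{w \<in> carrier L. x \<sqsubseteq>\<^bsub>L\<^esub> w \<and> w \<sqsubseteq>\<^bsub>L\<^esub> z} \<subseteq> {w \<in> carrier L. x \<sqsubseteq>\<^bsub>L\<^esub> w \<and> w \<sqsubseteq>\<^bsub>L\<^esub> y}"
    by blast
  moreover have "\<not> y \<sqsubseteq>\<^bsub>L\<^esub> z"
    using le_antisym[of z y] L z by blast
  then have "y \<notin> {w \<in> carrier L. x \<sqsubseteq>\<^bsub>L\<^esub> w \<and> w \<sqsubseteq>\<^bsub>L\<^esub> z}" "y \<in> {w \<in> carrier L. x \<sqsubseteq>\<^bsub>L\<^esub> w \<and> w \<sqsubseteq>\<^bsub>L\<^esub> y}"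
    using L le_refl[of y] by simp_all
  ultimately have "{w \<in> carrier L. x \<sqsubseteq>\<^bsub>L\<^esub> w \<and> w \<sqsubseteq>\<^bsub>L\<^esub> z} \<subset> {w \<in> carrier L. x \<sqsubseteq>\<^bsub>L\<^esub> w \<and> w \<sqsubseteq>\<^bsub>L\<^esub> y}"
    by blast
  then have "card {w \<in> carrier L. x \<sqsubseteq>\<^bsub>L\<^esub> w \<and> w \<sqsubseteq>\<^bsub>L\<^esub> z} < card {w \<in> carrier L. x \<sqsubseteq>\<^bsub>L\<^esub> w \<and> w \<sqsubseteq>\<^bsub>L\<^esub> y}"
    using L by (intro psubset_card_mono) simp_all
  then show "((L, x, z), (L, x, y))
      \<in> measure (\<lambda>(L, x, y). card {w \<in> carrier L. x \<sqsubseteq>\<^bsub>L\<^esub> w \<and> w \<sqsubseteq>\<^bsub>L\<^esub> y})"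
    by simp
qed simp

declare moebius.simps [simp del]

definition mu_epi ::
    "('a, 'x) monoid_scheme \<Rightarrow> ('b, 'y) monoid_scheme \<Rightarrow> ('a \<Rightarrow> 'b) \<Rightarrow> int" where
  "mu_epi G F \<pi> = moebius (quotient_lattice G F \<pi>) (kernel G F \<pi>) {\<one>\<^bsub>G\<^esub>}"

definition Z_epi ::
    "('a, 'x) monoid_scheme \<Rightarrow> ('b, 'y) monoid_scheme \<Rightarrow> ('a \<Rightarrow> 'b) \<Rightarrow> nat" where
  "Z_epi G F \<pi> = (let L = quotient_lattice G F \<pi> in
     card {H \<in> carrier L. \<forall>K\<^sub>1\<in>carrier L. \<forall>K\<^sub>2\<in>carrier L.
       H \<squnion>\<^bsub>L\<^esub> (K\<^sub>1 \<sqinter>\<^bsub>L\<^esub> K\<^sub>2) = (H \<squnion>\<^bsub>L\<^esub> K\<^sub>1) \<sqinter>\<^bsub>L\<^esub> (H \<squnion>\<^bsub>L\<^esub> K\<^sub>2)})"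


section \<open>Well-behaved tuples\<close>

text \<open>Extensionality is needed because members of \<^const>\<open>epi\<close> are arbitrary outside the
  carrier.\<close>

definition Epi :: "('a, 'x) monoid_scheme \<Rightarrow> ('b, 'y) monoid_scheme \<Rightarrow> ('a \<Rightarrow> 'b) set" where
  "Epi G F = epi G F \<inter> extensional (carrier G)"

text \<open>A tuple indexed by isomorphism classes is a function on \<^const>\<open>iso_classes\<close>; its values
  elsewhere are irrelevant. All terms are nonnegative, so \<open>summable_on\<close> says that the sum is
  finite.\<close>

definition well_behaved :: "(nat monoid set \<Rightarrow> real) \<Rightarrow> bool" where
  "well_behaved M \<longleftrightarrow>
     (\<forall>\<L> F. is_level \<L> \<longrightarrow> finite_group (F :: nat monoid) \<longrightarrow> iso_class F \<in> \<L> \<longrightarrow>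
       (\<lambda>\<C>. let G = representative \<C> in
          \<Sum>\<pi>\<in>Epi G F. \<bar>real_of_int (mu_epi G F \<pi>)\<bar> / real (card (auto G))
                        * real (Z_epi G F \<pi>) ^ 3 * \<bar>M \<C>\<bar>) summable_on \<L>)"


section \<open>Adequacy of the definitions\<close>

lemma factors_through_Mod_iff:
  assumes "group G" "group H" "N \<lhd> G" "r \<in> hom G H"
  shows "factors_through G (\<lambda>x. N #>\<^bsub>G\<^esub> x) (G Mod N) r H \<longleftrightarrow> N \<subseteq> kernel G H r"
proof
  interpret N: normal N G by fact
  interpret group_hom G H r using assms by (simp add: group_hom_def group_hom_axioms_def)
  {
    assume "factors_through G (\<lambda>x. N #>\<^bsub>G\<^esub> x) (G Mod N) r H"
    then obtain g where g: "g \<in> hom (G Mod N) H" "\<And>x. x \<in> carrier G \<Longrightarrow> r x = g (N #>\<^bsub>G\<^esub> x)"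
      unfolding factors_through_def by blast
    show "N \<subseteq> kernel G H r"
    proof
      fix x assume x: "x \<in> N"
      then have xG: "x \<in> carrier G" by (rule N.mem_carrier)
      have "N #>\<^bsub>G\<^esub> x = N" "N #>\<^bsub>G\<^esub> \<one>\<^bsub>G\<^esub> = N"
        using N.coset_join2[OF _ N.subgroup_axioms] x xG subgroup.one_closed[OF N.subgroup_axioms]
        by simp_all
      then show "x \<in> kernel G H r"
        using g(2)[OF xG] g(2)[of "\<one>\<^bsub>G\<^esub>"] xG by (simp add: kernel_def)
    qed
  next
    assume "N \<subseteq> kernel G H r"
    then obtain g where g: "g \<in> hom (G Mod N) H" "\<And>x. x \<in> carrier G \<Longrightarrow> g (N #>\<^bsub>G\<^esub> x) = r x"
      using FactGroup_universal_kernel[OF assms(3)] by metis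
    then have "\<forall>x\<in>carrier G. r x = g (N #>\<^bsub>G\<^esub> x)" by simp
    then show "factors_through G (\<lambda>x. N #>\<^bsub>G\<^esub> x) (G Mod N) r H"
      unfolding factors_through_def using g(1) by (rule bexI)
  }
qed

lemma kernel_coset_map:
  assumes "group G" "N \<lhd> G"
  shows "kernel G (G Mod N) (\<lambda>x. N #>\<^bsub>G\<^esub> x) = N"
proof -
  interpret N: normal N G by fact
  have "N #>\<^bsub>G\<^esub> x = N \<longleftrightarrow> x \<in> N" if "x \<in> carrier G" for x
    using that N.coset_join1[OF _ that N.subgroup_axioms] N.coset_join2[OF that N.subgroup_axioms]
    by auto
  then have "{x \<in> carrier G. N #>\<^bsub>G\<^esub> x = N} = N"
    using N.subset by blast
  then show ?thesis
    by (simp add: kernel_def FactGroup_def)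
qed

lemma quotient_unique_Mod:
  assumes "group G" "group H" "q \<in> epi G H"
  shows "\<exists>!N. N \<lhd> G \<and> (\<exists>i\<in>iso (G Mod N) H. \<forall>x\<in>carrier G. q x = i (N #>\<^bsub>G\<^esub> x))"
proof -
  interpret group_hom G H q using assms by (simp add: group_hom_def group_hom_axioms_def epi_def)
  let ?N = "kernel G H q"
  obtain i where i: "i \<in> hom (G Mod ?N) H" "\<And>x. x \<in> carrier G \<Longrightarrow> i (?N #>\<^bsub>G\<^esub> x) = q x"
    using FactGroup_universal_kernel normal_kernel by blast
  have "i ` carrier (G Mod ?N) = q ` carrier G"
    using i(2) by (force simp: carrier_FactGroup)
  moreover have "inj_on i (carrier (G Mod ?N))"
  proof (rule inj_onI)
    fix u v assume "u \<in> carrier (G Mod ?N)" "v \<in> carrier (G Mod ?N)" and uv: "i u = i v"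
    then obtain x y where x: "x \<in> carrier G" "u = ?N #>\<^bsub>G\<^esub> x" and y: "y \<in> carrier G" "v = ?N #>\<^bsub>G\<^esub> y"
      by (auto simp: carrier_FactGroup)
    with uv i(2) have "q x = q y" by simp
    with x y have "x \<in> ?N #>\<^bsub>G\<^esub> y"
      by (intro subgroup.rcos_module_rev[OF subgroup_kernel]) (auto simp: kernel_def)
    then show "u = v"
      using x y G.repr_independence subgroup_kernel by blast
  qed
  ultimately have "i \<in> iso (G Mod ?N) H"
    using i(1) assms(3) by (auto simp: iso_def bij_betw_def epi_def)
  then have ex: "?N \<lhd> G \<and> (\<exists>i\<in>iso (G Mod ?N) H. \<forall>x\<in>carrier G. q x = i (?N #>\<^bsub>G\<^esub> x))"
    using normal_kernel i(2) by (metis (no_types))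
  have unique: "N = ?N" if N: "N \<lhd> G \<and> (\<exists>i\<in>iso (G Mod N) H. \<forall>x\<in>carrier G. q x = i (N #>\<^bsub>G\<^esub> x))" for N
  proof -
    obtain j where j: "j \<in> iso (G Mod N) H" "\<And>x. x \<in> carrier G \<Longrightarrow> q x = j (N #>\<^bsub>G\<^esub> x)"
      using N by auto
    interpret N: normal N G using N by simp
    have "kernel (G Mod N) H j = {\<one>\<^bsub>G Mod N\<^esub>}"
      using j(1) iso_kernel_image[OF N.factorgroup_is_group assms(2)] by blast
    then have jU: "j U = \<one>\<^bsub>H\<^esub> \<longleftrightarrow> U = \<one>\<^bsub>G Mod N\<^esub>" if "U \<in> carrier (G Mod N)" for U
      using that by (auto simp: kernel_def)
    have "q x = \<one>\<^bsub>H\<^esub> \<longleftrightarrow> N #>\<^bsub>G\<^esub> x = \<one>\<^bsub>G Mod N\<^esub>" if "x \<in> carrier G" for x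
      using jU[of "N #>\<^bsub>G\<^esub> x"] j(2)[OF that] that by (simp add: carrier_FactGroup)
    then have "?N = kernel G (G Mod N) (\<lambda>x. N #>\<^bsub>G\<^esub> x)"
      unfolding kernel_def by blast
    then show "N = ?N"
      using kernel_coset_map N assms(1) by blast
  qed
  show ?thesis
    using ex unique by (rule ex1I)
qed

lemma quotient_lattice_carrier:
  assumes "group G" "group F" "\<pi> \<in> epi G F"
  shows "carrier (quotient_lattice G F \<pi>) = {N. N \<lhd> G \<and> N \<subseteq> kernel G F \<pi>}"
  using factors_through_Mod_iff[OF assms(1,2)] assms(3)
  by (auto simp: quotient_lattice_def epi_def)

lemma quotient_lattice_le:
  assumes "group G" "N \<lhd> G" "N' \<lhd> G"
  shows "N' \<sqsubseteq>\<^bsub>quotient_lattice G F \<pi>\<^esub> N \<longleftrightarrow> N \<subseteq> N'"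
  using factors_through_Mod_iff[OF assms(1) normal.factorgroup_is_group assms(2)
      normal.r_coset_hom_Mod, OF assms(3,3)] kernel_coset_map[OF assms(1,3)]
  by (simp add: quotient_lattice_def)

lemma quotient_lattice_eq [simp]: "(.=\<^bsub>quotient_lattice G F \<pi>\<^esub>) = (=)"
  by (simp add: quotient_lattice_def)

lemma finite_quotient_lattice:
  assumes "finite_group G"
  shows "finite (carrier (quotient_lattice G F \<pi>))"
proof (rule finite_subset)
  show "carrier (quotient_lattice G F \<pi>) \<subseteq> Pow (carrier G)"
    by (auto simp: quotient_lattice_def dest!: normal_imp_subgroup subgroup.subset)
qed (use assms in \<open>simp add: finite_group_def\<close>)

lemma lattice_quotient_lattice:
  assumes "group G" "group F" "\<pi> \<in> epi G F"
  shows "lattice (quotient_lattice G F \<pi>)"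
proof -
  let ?L = "quotient_lattice G F \<pi>"
  interpret group_hom G F \<pi> using assms by (simp add: group_hom_def group_hom_axioms_def epi_def)
  note C = quotient_lattice_carrier[OF assms]
  have le: "N' \<sqsubseteq>\<^bsub>?L\<^esub> N \<longleftrightarrow> N \<subseteq> N'" if "N \<in> carrier ?L" "N' \<in> carrier ?L" for N N'
    using that unfolding C by (simp add: quotient_lattice_le[OF assms(1)])
  have po: "partial_order ?L"
  proof
    fix x y z assume "x \<in> carrier ?L" "y \<in> carrier ?L" "z \<in> carrier ?L"
      "x \<sqsubseteq>\<^bsub>?L\<^esub> y" "y \<sqsubseteq>\<^bsub>?L\<^esub> z"
    then show "x \<sqsubseteq>\<^bsub>?L\<^esub> z"
      by (simp add: le)
  qed (simp_all add: le)
  have join: "\<exists>s. least ?L s (Upper ?L {x, y})" if xy: "x \<in> carrier ?L" "y \<in> carrier ?L" for x y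
  proof
    have xy': "{x, y} \<subseteq> carrier ?L" using xy by simp
    have I: "x \<inter> y \<in> carrier ?L"
      using xy G.normal_subgroup_intersect[of x y] unfolding C by blast
    show "least ?L (x \<inter> y) (Upper ?L {x, y})"
    proof (rule least_UpperI[OF _ _ xy' I])
      fix z assume "z \<in> {x, y}"
      then show "z \<sqsubseteq>\<^bsub>?L\<^esub> x \<inter> y"
        using le[OF I] xy by blast
    next
      fix z assume "z \<in> Upper ?L {x, y}"
      from Upper_memD[OF this _ xy', of x] Upper_memD[OF this _ xy', of y]
      have "z \<in> carrier ?L" "x \<sqsubseteq>\<^bsub>?L\<^esub> z" "y \<sqsubseteq>\<^bsub>?L\<^esub> z"
        by simp_all
      then show "x \<inter> y \<sqsubseteq>\<^bsub>?L\<^esub> z"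
        using le[of z] I xy by simp
    qed
  qed
  have meet: "\<exists>s. greatest ?L s (Lower ?L {x, y})" if xy: "x \<in> carrier ?L" "y \<in> carrier ?L" for x y
  proof
    define D where "D = \<Inter>{N. N \<lhd> G \<and> x \<subseteq> N \<and> y \<subseteq> N}"
    have ker: "kernel G F \<pi> \<in> {N. N \<lhd> G \<and> x \<subseteq> N \<and> y \<subseteq> N}"
      using xy normal_kernel unfolding C by simp
    have "subgroup D G"
      unfolding D_def
    proof (rule G.subgroups_Inter)
      show "subgroup N G" if "N \<in> {N. N \<lhd> G \<and> x \<subseteq> N \<and> y \<subseteq> N}" for N
        using that by (simp add: normal_imp_subgroup)
    qed (use ker in blast)
    moreover have "g \<otimes>\<^bsub>G\<^esub> h \<otimes>\<^bsub>G\<^esub> inv\<^bsub>G\<^esub> g \<in> D" if "g \<in> carrier G" "h \<in> D" for g h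
      unfolding D_def
    proof (rule InterI)
      fix N assume N: "N \<in> {N. N \<lhd> G \<and> x \<subseteq> N \<and> y \<subseteq> N}"
      then have "h \<in> N" using \<open>h \<in> D\<close> unfolding D_def by blast
      with N \<open>g \<in> carrier G\<close> show "g \<otimes>\<^bsub>G\<^esub> h \<otimes>\<^bsub>G\<^esub> inv\<^bsub>G\<^esub> g \<in> N"
        by (simp add: normal.inv_op_closed2)
    qed
    ultimately have "D \<lhd> G"
      unfolding G.normal_inv_iff by simp
    moreover have "D \<subseteq> kernel G F \<pi>"
      unfolding D_def using ker by (rule Inter_lower)
    ultimately have D: "D \<in> carrier ?L"
      unfolding C by simp
    have xy': "{x, y} \<subseteq> carrier ?L" using xy by simp
    show "greatest ?L D (Lower ?L {x, y})"
    proof (rule greatest_LowerI[OF _ _ xy' D])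
      fix z assume "z \<in> {x, y}"
      then have "z \<in> carrier ?L" "z \<subseteq> D"
        using xy unfolding D_def by blast+
      then show "D \<sqsubseteq>\<^bsub>?L\<^esub> z"
        using le[OF _ D] by simp
    next
      fix z assume "z \<in> Lower ?L {x, y}"
      from Lower_memD[OF this _ xy', of x] Lower_memD[OF this _ xy', of y]
      have z: "z \<in> carrier ?L" "z \<sqsubseteq>\<^bsub>?L\<^esub> x" "z \<sqsubseteq>\<^bsub>?L\<^esub> y"
        by simp_all
      then have "z \<lhd> G" "x \<subseteq> z" "y \<subseteq> z"
        using le[OF _ z(1)] xy unfolding C by simp_all
      then have "D \<subseteq> z"
        unfolding D_def by blast
      then show "z \<sqsubseteq>\<^bsub>?L\<^esub> D"
        using le[OF D z(1)] by simp
    qed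
  qed
  show ?thesis
    using po join meet
    by (simp add: lattice_def upper_semilattice_def lower_semilattice_def
        upper_semilattice_axioms_def lower_semilattice_axioms_def)
qed

lemma quotient_lattice_bounds:
  assumes "group G" "group F" "\<pi> \<in> epi G F"
  shows "least (quotient_lattice G F \<pi>) (kernel G F \<pi>) (carrier (quotient_lattice G F \<pi>))"
    and "greatest (quotient_lattice G F \<pi>) {\<one>\<^bsub>G\<^esub>} (carrier (quotient_lattice G F \<pi>))"
proof -
  let ?L = "quotient_lattice G F \<pi>"
  interpret group_hom G F \<pi> using assms by (simp add: group_hom_def group_hom_axioms_def epi_def)
  note C = quotient_lattice_carrier[OF assms]
  have k: "kernel G F \<pi> \<in> carrier ?L" using C normal_kernel by simp
  have o: "{\<one>\<^bsub>G\<^esub>} \<in> carrier ?L" using C G.one_is_normal by (simp add: kernel_def)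
  have le: "N' \<sqsubseteq>\<^bsub>?L\<^esub> N \<longleftrightarrow> N \<subseteq> N'" if "N \<in> carrier ?L" "N' \<in> carrier ?L" for N N'
    using that unfolding C by (simp add: quotient_lattice_le[OF assms(1)])
  have bounds: "N \<subseteq> kernel G F \<pi>" "\<one>\<^bsub>G\<^esub> \<in> N" if "N \<in> carrier ?L" for N
    using that subgroup.one_closed[OF normal_imp_subgroup] unfolding C by auto
  show "least ?L (kernel G F \<pi>) (carrier ?L)"
    using k le bounds(1) by (simp add: least_def)
  show "greatest ?L {\<one>\<^bsub>G\<^esub>} (carrier ?L)"
    using o le bounds(2) by (simp add: greatest_def)
qed

end

theory Submission
  imports Defs
begin

text \<open>Fix a level and a group \<open>F\<close>. The terms of the series are estimated through decompositions of the
kernel \<open>K\<close> of an epimorphism \<open>\<pi>\<close> from \<open>G\<close> to \<open>F\<close>: lists \<open>R\<^sub>1, \<dots>, R\<^sub>\<ell>\<close> of maximal members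
among the proper subgroups of \<open>K\<close> that are normal in \<open>G\<close>, with trivial intersection and such
that no \<open>R\<^sub>i\<close> contains the intersection of those after it. Every factor of a summand is
controlled by \<open>\<ell>\<close>.

\<^item> Weisner's theorem gives, by induction in the lattice, \<open>\<bar>\<mu>(\<pi>)\<bar> \<le> \<Sum> 1 / \<ell>!\<close>, the sum being over all
  decompositions of \<open>K\<close> (\<open>abs_mu_epi_le\<close>). The factorial arises because Weisner's theorem can be
  applied with each of at least \<open>\<ell>\<close> maximal subgroups, and the resulting bounds are averaged.

\<^item> In a level, chief factors have bounded order: subdirect products and quotients create no new
  ones (\<open>generated_level_refinable\<close>). So \<open>\<bar>G\<bar> \<le> \<bar>F\<bar> B^\<ell>\<close> for a constant \<open>B\<close>
  (\<open>card_le_power_length\<close>), and a power of \<open>\<bar>G\<bar>\<close> is exponential in \<open>\<ell>\<close>.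

\<^item> A distributive element of the lattice is the intersection of \<open>K\<close> with the \<open>R\<^sub>i\<close> containing it, so
  \<open>Z(\<pi>) \<le> 2^\<ell>\<close> (\<open>Z_epi_le\<close>).

\<^item> By the Chinese remainder theorem \<open>G\<close> is the fibre product over \<open>F\<close> of the groups \<open>G / R\<^sub>i\<close>.
  These have order at most \<open>\<bar>F\<bar> B\<close>, hence finitely many isomorphism types over \<open>F\<close>; attach to a
  pair of \<open>\<pi>\<close> and a decomposition the list of types. Pairs with the same list, possibly for
  different groups \<open>G\<close>, differ by an isomorphism (\<open>chief_decomposition_rigid\<close>). So a list of types
  determines \<open>G\<close> and is attached to at most \<open>\<bar>Aut(G)\<bar>\<close> pairs (\<open>card_code_fibre\<close>).

Dividing by \<open>\<bar>Aut(G)\<bar>\<close> therefore turns the whole series into a sum over lists of types, which is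
at most \<open>\<Sum> \<bar>T\<bar>^\<ell> A D^\<ell> / \<ell>! = A exp(\<bar>T\<bar> D)\<close>, where \<open>T\<close> is the finite set of types. In this way
the automorphisms of \<open>G\<close> compensate for the size of \<open>\<mu>\<close>.\<close>

section \<open>Moebius functions of intersection-closed families\<close>

primrec irredundant :: "'a set set \<Rightarrow> 'a set \<Rightarrow> 'a set list \<Rightarrow> bool" where
  "irredundant \<A> K [] \<longleftrightarrow> True"
| "irredundant \<A> K (R # Rs) \<longleftrightarrow> R \<in> \<A> \<and> \<not> foldr (\<inter>) Rs K \<subseteq> R \<and> irredundant \<A> K Rs"

definition decompositions :: "'a set set \<Rightarrow> 'a set \<Rightarrow> 'a set \<Rightarrow> 'a set list set" where
  "decompositions \<A> K U = {Rs. irredundant \<A> K Rs \<and> foldr (\<inter>) Rs K = U}"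

lemma foldr_Int_subset: "foldr (\<inter>) Rs K \<subseteq> K"
  by (induction Rs) auto

lemma foldr_Int_lower: "R \<in> set Rs \<Longrightarrow> foldr (\<inter>) Rs K \<subseteq> R"
  by (induction Rs) auto

lemma irredundant_distinct: "irredundant \<A> K Rs \<Longrightarrow> distinct Rs \<and> set Rs \<subseteq> \<A>"
proof (induction Rs)
  case (Cons R Rs)
  have "R \<notin> set Rs"
    using foldr_Int_lower[of R Rs K] Cons.prems by auto
  with Cons show ?case by simp
qed simp

lemma finite_decompositions:
  assumes "finite \<A>" shows "finite (decompositions \<A> K U)"
proof (rule finite_subset)
  show "decompositions \<A> K U \<subseteq> {Rs. set Rs \<subseteq> \<A> \<and> distinct Rs}"
    using irredundant_distinct by (auto simp: decompositions_def)
qed (rule finite_subset_distinct[OF assms])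

text \<open>The members are the kernels of the quotients in a lattice like \<open>[F, G]\<close>, whose order is reversed
inclusion and whose joins are intersections. \<open>\<mu> U\<close> is the Moebius function from the minimum, with
kernel \<open>K\<close>, to the quotient with kernel \<open>U\<close>, and \<open>mu_sum\<close> is its recursion.\<close>

locale intersection_family =
  fixes \<K> :: "'a set set" and K :: "'a set" and \<mu> :: "'a set \<Rightarrow> real"
  assumes finite_family: "finite \<K>"
    and top_mem: "K \<in> \<K>"
    and top: "U \<in> \<K> \<Longrightarrow> U \<subseteq> K"
    and Int_mem: "U \<in> \<K> \<Longrightarrow> Y \<in> \<K> \<Longrightarrow> U \<inter> Y \<in> \<K>"
    and mu_sum: "U \<in> \<K> \<Longrightarrow> (\<Sum>Y | Y \<in> \<K> \<and> U \<subseteq> Y. \<mu> Y) = (if U = K then 1 else 0)"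
begin

lemma above_induct [consumes 1, case_names above]:
  assumes "U \<in> \<K>"
    and step: "\<And>U. U \<in> \<K> \<Longrightarrow> (\<And>Y. Y \<in> \<K> \<Longrightarrow> U \<subset> Y \<Longrightarrow> P Y) \<Longrightarrow> P U"
  shows "P U"
  using assms(1)
proof (induction "card {Y \<in> \<K>. U \<subset> Y}" arbitrary: U rule: less_induct)
  case less
  have "card {Z \<in> \<K>. Y \<subset> Z} < card {Z \<in> \<K>. U \<subset> Z}" if "Y \<in> \<K>" "U \<subset> Y" for Y
    using that finite_family by (intro psubset_card_mono) auto
  then show ?case
    by (intro step[OF less.prems] less.hyps)
qed

text \<open>The total of \<open>\<mu>\<close> over all members above \<open>U\<close> vanishes. Grouping these members by their
intersection with \<open>R\<close>, which lies between \<open>U\<close> and \<open>R\<close>, all groups but the one at \<open>U\<close> vanish by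
induction.\<close>

lemma weisner:
  assumes "U \<in> \<K>" "R \<in> \<K>" "R \<noteq> K" "U \<subseteq> R"
  shows "(\<Sum>Y | Y \<in> \<K> \<and> Y \<inter> R = U. \<mu> Y) = 0"
  using assms(1,4)
proof (induction U rule: above_induct)
  case (above U)
  let ?T = "{Z \<in> \<K>. U \<subseteq> Z \<and> Z \<subseteq> R}"
  let ?S = "{Y \<in> \<K>. U \<subseteq> Y}"
  have "U \<noteq> K"
    using above.prems top[OF assms(2)] assms(3) by blast
  then have "0 = (\<Sum>Y\<in>?S. \<mu> Y)"
    using mu_sum[OF above.hyps] by simp
  also have "\<dots> = (\<Sum>Z\<in>?T. \<Sum>Y | Y \<in> ?S \<and> Y \<inter> R = Z. \<mu> Y)"
    using finite_family above.prems Int_mem assms(2)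
    by (intro sum.group[symmetric]) auto
  also have "\<dots> = (\<Sum>Z\<in>?T. \<Sum>Y | Y \<in> \<K> \<and> Y \<inter> R = Z. \<mu> Y)"
    by (intro sum.cong refl) auto
  also have "\<dots> = (\<Sum>Z\<in>{U}. \<Sum>Y | Y \<in> \<K> \<and> Y \<inter> R = Z. \<mu> Y)"
    using above finite_family by (intro sum.mono_neutral_right) auto
  finally show ?case by simp
qed

lemma abs_mu_le_complements:
  assumes "U \<in> \<K>" "R \<in> \<K>" "R \<noteq> K" "U \<subseteq> R"
  shows "\<bar>\<mu> U\<bar> \<le> (\<Sum>Y | Y \<in> \<K> \<and> Y \<inter> R = U \<and> Y \<noteq> U. \<bar>\<mu> Y\<bar>)"
proof -
  have "{Y \<in> \<K>. Y \<inter> R = U} = insert U {Y \<in> \<K>. Y \<inter> R = U \<and> Y \<noteq> U}"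
    using assms by auto
  with weisner[OF assms] have "\<mu> U = - (\<Sum>Y | Y \<in> \<K> \<and> Y \<inter> R = U \<and> Y \<noteq> U. \<mu> Y)"
    using finite_family by simp
  then show ?thesis
    using sum_abs[of \<mu> "{Y \<in> \<K>. Y \<inter> R = U \<and> Y \<noteq> U}"] by simp
qed

text \<open>Induction downwards from \<open>K\<close>. For each \<open>R \<in> \<A>\<close> above \<open>U\<close>, Weisner's theorem bounds \<open>\<bar>\<mu> U\<bar>\<close> by the
\<open>\<bar>\<mu> Y\<bar>\<close> with \<open>Y \<inter> R = U\<close>, and a decomposition of such a \<open>Y\<close> becomes one of \<open>U\<close> when \<open>R\<close> is put in
front. Averaging over the \<open>a\<close> possible \<open>R\<close> gains a factor \<open>1 / a\<close>; since the entries of a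
decomposition of \<open>U\<close> are distinct members of \<open>\<A>\<close> above \<open>U\<close>, its length is at most \<open>a\<close>, which
turns \<open>1 / fact \<ell>\<close> into \<open>1 / fact (Suc \<ell>)\<close>.\<close>

theorem abs_mu_le_decompositions:
  assumes \<A>: "\<A> \<subseteq> \<K> - {K}" "\<And>U. U \<in> \<K> \<Longrightarrow> U \<noteq> K \<Longrightarrow> \<exists>R\<in>\<A>. U \<subseteq> R"
    and "U \<in> \<K>"
  shows "\<bar>\<mu> U\<bar> \<le> (\<Sum>Rs\<in>decompositions \<A> K U. 1 / fact (length Rs))"
  using assms(3)
proof (induction U rule: above_induct)
  case (above U)
  have fin: "finite \<A>"
    by (rule finite_subset[OF \<A>(1)]) (simp add: finite_family)
  show ?case
  proof (cases "U = K")
    case True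
    have "(\<Sum>Y | Y \<in> \<K> \<and> K \<subseteq> Y. \<mu> Y) = (\<Sum>Y\<in>{K}. \<mu> Y)"
      using top top_mem by (intro sum.cong) auto
    then have "\<mu> K = 1"
      using mu_sum[OF top_mem] by simp
    moreover have "[] \<in> decompositions \<A> K K"
      by (simp add: decompositions_def)
    then have "1 \<le> (\<Sum>Rs\<in>decompositions \<A> K K. 1 / fact (length Rs) :: real)"
      using member_le_sum[of "[]" "decompositions \<A> K K" "\<lambda>Rs. 1 / fact (length Rs) :: real"]
        finite_decompositions[OF fin] by simp
    ultimately show ?thesis using True by simp
  next
    case False
    define \<B> where "\<B> = {R \<in> \<A>. U \<subseteq> R}"
    define \<C> where "\<C> R = {Y \<in> \<K>. Y \<inter> R = U \<and> Y \<noteq> U}" for R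
    let ?a = "real (card \<B>)" and ?D = "decompositions \<A> K"
    let ?S = "Sigma \<B> (\<lambda>R. Sigma (\<C> R) ?D)"
    let ?g = "\<lambda>(R, Y, Rs). R # Rs"
    have finB: "finite \<B>" "\<And>R. finite (\<C> R)"
      using fin finite_family by (auto simp: \<B>_def \<C>_def)
    have a: "?a > 0"
      using \<A>(2)[OF above.hyps False] finB by (auto simp: card_gt_0_iff \<B>_def)
    have g: "?g t \<in> ?D U \<and> length (?g t) \<le> card \<B>" if t: "t \<in> ?S" for t
    proof -
      obtain R Y Rs where t': "t = (R, Y, Rs)" by (cases t)
      have R: "R \<in> \<A>" "Y \<inter> R = U" "Y \<noteq> U"
        and Rs: "irredundant \<A> K Rs" "foldr (\<inter>) Rs K = Y"
        using t unfolding t' by (simp_all add: \<B>_def \<C>_def decompositions_def)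
      have "\<not> Y \<subseteq> R" using R by blast
      then have D: "R # Rs \<in> ?D U"
        using R Rs by (simp add: decompositions_def Int_commute)
      then have "distinct (R # Rs)" "set (R # Rs) \<subseteq> \<A>" "\<And>Q. Q \<in> set (R # Rs) \<Longrightarrow> U \<subseteq> Q"
        using irredundant_distinct[of \<A> K "R # Rs"] foldr_Int_lower[of _ "R # Rs" K]
        unfolding decompositions_def by blast+
      then have "distinct (R # Rs)" "set (R # Rs) \<subseteq> \<B>"
        unfolding \<B>_def by blast+
      then have "length (R # Rs) \<le> card \<B>"
        using finB by (metis card_mono distinct_card)
      with D t' show ?thesis by simp
    qed
    have inj: "inj_on ?g ?S"
      by (auto simp: inj_on_def decompositions_def)
    have "?a * \<bar>\<mu> U\<bar> = (\<Sum>R\<in>\<B>. \<bar>\<mu> U\<bar>)" by simp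
    also have "\<dots> \<le> (\<Sum>R\<in>\<B>. \<Sum>Y\<in>\<C> R. \<bar>\<mu> Y\<bar>)"
      unfolding \<C>_def using \<A> above.hyps
      by (intro sum_mono abs_mu_le_complements) (auto simp: \<B>_def)
    also have "\<dots> \<le> (\<Sum>R\<in>\<B>. \<Sum>Y\<in>\<C> R. \<Sum>Rs\<in>?D Y. 1 / fact (length Rs))"
      by (intro sum_mono above.IH) (auto simp: \<B>_def \<C>_def)
    also have "\<dots> = (\<Sum>(R, Y, Rs)\<in>?S. 1 / fact (length Rs))"
      using finB finite_decompositions[OF fin] by (simp add: sum.Sigma)
    also have "\<dots> \<le> (\<Sum>t\<in>?S. ?a * (1 / fact (length (?g t))))"
    proof (intro sum_mono)
      fix t assume "t \<in> ?S"
      moreover obtain R Y Rs where t: "t = (R, Y, Rs)" by (cases t)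
      ultimately have "real (length Rs) + 1 \<le> ?a" using g[of t] by simp
      then show "(case t of (R, Y, Rs) \<Rightarrow> 1 / fact (length Rs)) \<le> ?a * (1 / fact (length (?g t)))"
        by (simp add: t divide_simps)
    qed
    also have "\<dots> = ?a * (\<Sum>Rs\<in>?g ` ?S. 1 / fact (length Rs))"
      unfolding sum.reindex[OF inj] by (simp add: sum_distrib_left)
    also have "\<dots> \<le> ?a * (\<Sum>Rs\<in>?D U. 1 / fact (length Rs))"
      using g a finite_decompositions[OF fin]
      by (intro mult_left_mono sum_mono2) auto
    finally show ?thesis using a by simp
  qed
qed

end

section \<open>Orders of images and products of subgroups\<close>

lemma (in group_hom) card_subgroup_hom:
  assumes A: "subgroup A G" "finite A"
  shows "card A = card (h ` A) * card (A \<inter> kernel G H h)"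
proof -
  interpret A: subgroup A G by (rule A(1))
  have "card {x \<in> A. h x = y} = card (A \<inter> kernel G H h)" if y: "y \<in> h ` A" for y
  proof -
    obtain a where a: "y = h a" "a \<in> A" using y by (rule imageE)
    have aG: "a \<in> carrier G" using a A.mem_carrier by simp
    have "bij_betw (\<lambda>x. inv a \<otimes> x) {x \<in> A. h x = y} (A \<inter> kernel G H h)"
    proof (rule bij_betwI[where g = "\<lambda>x. a \<otimes> x"])
      show "(\<lambda>x. inv a \<otimes> x) \<in> {x \<in> A. h x = y} \<rightarrow> A \<inter> kernel G H h"
      proof
        fix x assume "x \<in> {x \<in> A. h x = y}"
        then have x: "x \<in> A" "h x = h a" using a by simp_all
        then have "h (inv a \<otimes> x) = \<one>\<^bsub>H\<^esub>"
          using aG A.mem_carrier[OF x(1)] by simp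
        with x a aG show "inv a \<otimes> x \<in> A \<inter> kernel G H h"
          using A.mem_carrier[OF x(1)] by (simp add: kernel_def)
      qed
      show "(\<lambda>x. a \<otimes> x) \<in> A \<inter> kernel G H h \<rightarrow> {x \<in> A. h x = y}"
        using a aG by (simp add: kernel_def)
      show "a \<otimes> (inv a \<otimes> x) = x" if "x \<in> {x \<in> A. h x = y}" for x
        using that aG A.mem_carrier[of x] by (simp add: G.m_assoc[symmetric])
      show "inv a \<otimes> (a \<otimes> x) = x" if "x \<in> A \<inter> kernel G H h" for x
        using that aG A.mem_carrier[of x] by (simp add: G.m_assoc[symmetric])
    qed
    then show ?thesis by (rule bij_betw_same_card)
  qed
  then have "(\<Sum>y\<in>h ` A. \<Sum>x | x \<in> A \<and> h x = y. (1::nat)) = (\<Sum>y\<in>h ` A. card (A \<inter> kernel G H h))"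
    by (intro sum.cong) auto
  then show ?thesis
    using sum.image_gen[OF A(2), of "\<lambda>_. 1::nat" h] by simp
qed

lemma (in group) subset_set_mult:
  assumes "subgroup R G" "subgroup V G"
  shows "R \<subseteq> R <#> V" "V \<subseteq> R <#> V"
proof -
  interpret R: subgroup R G by fact
  interpret V: subgroup V G by fact
  show "R \<subseteq> R <#> V"
  proof
    fix x assume "x \<in> R"
    then have "x \<otimes> \<one> \<in> R <#> V"
      using V.one_closed unfolding set_mult_def by blast
    then show "x \<in> R <#> V" using \<open>x \<in> R\<close> by simp
  qed
  show "V \<subseteq> R <#> V"
  proof
    fix x assume "x \<in> V"
    then have "\<one> \<otimes> x \<in> R <#> V"
      using R.one_closed unfolding set_mult_def by blast
    then show "x \<in> R <#> V" using \<open>x \<in> V\<close> by simp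
  qed
qed

text \<open>\<open>R <#> V\<close> and \<open>V\<close> have the same image modulo \<open>R\<close>.\<close>

lemma (in group) card_set_mult_normal:
  assumes "finite (carrier G)" "R \<lhd> G" "V \<lhd> G"
  shows "card (R <#> V) * card (V \<inter> R) = card R * card V"
proof -
  interpret R: normal R G by fact
  interpret V: normal V G by fact
  let ?q = "\<lambda>x. R #> x"
  interpret q: group_hom G "G Mod R" ?q
    by (intro group_hom.intro group_hom_axioms.intro is_group R.factorgroup_is_group R.r_coset_hom_Mod)
  have fin: "finite A" if "A \<subseteq> carrier G" for A
    using that assms(1) finite_subset by blast
  have RV: "R <#> V \<lhd> G"
    using assms by (intro normal_subgroup_set_mult_closed)
  then have sub: "subgroup (R <#> V) G" by (rule normal_imp_subgroup)
  note incl = subset_set_mult[OF R.subgroup_axioms V.subgroup_axioms]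
  have ker: "kernel G (G Mod R) ?q = R"
    using assms(2) kernel_coset_map[OF is_group] by simp
  have img: "?q ` (R <#> V) = ?q ` V"
  proof
    show "?q ` (R <#> V) \<subseteq> ?q ` V"
    proof
      fix y assume "y \<in> ?q ` (R <#> V)"
      then obtain r v where rv: "r \<in> R" "v \<in> V" "y = R #> (r \<otimes> v)"
        unfolding set_mult_def by auto
      have "R #> (r \<otimes> v) = R #> r #> v"
        using rv by (intro coset_mult_assoc[symmetric]) (auto simp: R.subset)
      also have "R #> r = R"
        using rv R.rcos_const[OF is_group] by simp
      finally show "y \<in> ?q ` V" using rv by blast
    qed
    show "?q ` V \<subseteq> ?q ` (R <#> V)"
      using incl(2) by blast
  qed
  have "card (R <#> V) = card (?q ` (R <#> V)) * card ((R <#> V) \<inter> R)"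
    using q.card_subgroup_hom[OF sub fin[OF subgroup.subset[OF sub]]] unfolding ker .
  also have "(R <#> V) \<inter> R = R" using incl(1) by blast
  finally have 1: "card (R <#> V) = card (?q ` V) * card R" unfolding img .
  have "card V = card (?q ` V) * card (V \<inter> R)"
    using q.card_subgroup_hom[OF V.subgroup_axioms fin[OF V.subset]] unfolding ker .
  with 1 show ?thesis by (simp add: ac_simps)
qed

lemma (in group) set_mult_subset:
  assumes "subgroup K G" "R \<subseteq> K" "V \<subseteq> K"
  shows "R <#> V \<subseteq> K"
  using assms subgroup.m_closed[OF assms(1)] unfolding set_mult_def by blast

lemma (in group_hom) normal_vimage:
  assumes "R \<lhd> H"
  shows "{x \<in> carrier G. h x \<in> R} \<lhd> G"
proof -
  interpret R: normal R H by fact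
  show ?thesis
  proof (rule G.normal_invI)
    show "subgroup {x \<in> carrier G. h x \<in> R} G"
      by (rule subgroup.intro) auto
  qed (auto simp: R.inv_op_closed2)
qed

lemma (in group_hom) normal_image:
  assumes "V \<lhd> G" "h ` carrier G = carrier H"
  shows "h ` V \<lhd> H"
  using normal.surj_hom_normal_subgroup[OF assms(1) group_hom_axioms assms(2)] .


section \<open>Bounded chief factors\<close>

text \<open>In a finite group this says that the chief factors have order at most \<open>B\<close>. Stated for
arbitrary \<open>R \<subset> K\<close>, it passes to images by taking preimages of \<open>R\<close> and \<open>K\<close>, and to subdirect
products.\<close>

definition refinable :: "nat \<Rightarrow> ('a, 'b) monoid_scheme \<Rightarrow> bool" where
  "refinable B G \<longleftrightarrow>
     (\<forall>R K. R \<lhd> G \<longrightarrow> K \<lhd> G \<longrightarrow> R \<subset> K \<longrightarrow>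
        (\<exists>V. V \<lhd> G \<and> R \<subset> V \<and> V \<subseteq> K \<and> card V \<le> B * card R))"

lemma refinableD:
  assumes "refinable B G" "R \<lhd> G" "K \<lhd> G" "R \<subset> K"
  obtains V where "V \<lhd> G" "R \<subset> V" "V \<subseteq> K" "card V \<le> B * card R"
  using assms unfolding refinable_def by metis

lemma (in group) refinable_order:
  assumes "finite (carrier G)" "order G \<le> B"
  shows "refinable B G"
  unfolding refinable_def
proof (intro allI impI)
  fix R K assume R: "R \<lhd> G" and K: "K \<lhd> G" and RK: "R \<subset> K"
  interpret R: normal R G by fact
  interpret K: normal K G by fact
  have "finite R" using R.subset assms(1) by (rule finite_subset)
  then have "card R \<ge> 1"
    using R.one_closed by (metis One_nat_def Suc_leI card_gt_0_iff empty_iff)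
  moreover have "card K \<le> B"
    using card_mono[OF assms(1) K.subset] assms(2) by (simp add: order_def)
  ultimately have "card K \<le> B * card R"
    by (metis le_trans mult.right_neutral mult_le_mono2)
  with K RK show "\<exists>V. V \<lhd> G \<and> R \<subset> V \<and> V \<subseteq> K \<and> card V \<le> B * card R" by blast
qed

lemma (in group_hom) refinable_image:
  assumes fin: "finite (carrier G)" and surj: "h ` carrier G = carrier H" and G: "refinable B G"
  shows "refinable B H"
  unfolding refinable_def
proof (intro allI impI)
  fix R K assume R: "R \<lhd> H" and K: "K \<lhd> H" and RK: "R \<subset> K"
  interpret R: normal R H by fact
  interpret K: normal K H by fact
  let ?pre = "\<lambda>A. {x \<in> carrier G. h x \<in> A}"
  have im: "h ` ?pre A = A" if A: "A \<subseteq> carrier H" for A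
  proof
    show "h ` ?pre A \<subseteq> A" by blast
    show "A \<subseteq> h ` ?pre A"
    proof
      fix y assume y: "y \<in> A"
      then have "y \<in> h ` carrier G" using A surj by blast
      then obtain x where "y = h x" "x \<in> carrier G" by (rule imageE)
      with y show "y \<in> h ` ?pre A" by simp
    qed
  qed
  have "?pre R \<subseteq> ?pre K" using RK by blast
  moreover have "?pre R \<noteq> ?pre K"
  proof
    assume "?pre R = ?pre K"
    then have "h ` ?pre R = h ` ?pre K" by (rule arg_cong)
    then show False unfolding im[OF R.subset] im[OF K.subset] using RK by simp
  qed
  ultimately have pre: "?pre R \<subset> ?pre K" by (rule psubsetI)
  obtain V where V: "V \<lhd> G" "?pre R \<subset> V" "V \<subseteq> ?pre K" "card V \<le> B * card (?pre R)"
    by (rule refinableD[OF G normal_vimage[OF R] normal_vimage[OF K] pre])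
  have VG: "V \<subseteq> carrier G" using V(3) by blast
  have kerR: "kernel G H h \<subseteq> ?pre R" by (auto simp: kernel_def)
  have finV: "finite V" "finite (?pre R)" using VG fin finite_subset by auto
  have "V \<inter> kernel G H h = kernel G H h" using kerR V(2) by blast
  then have "card V = card (h ` V) * card (kernel G H h)"
    using card_subgroup_hom[OF normal_imp_subgroup[OF V(1)] finV(1)] by simp
  moreover have "card (?pre R) = card R * card (kernel G H h)"
    using card_subgroup_hom[OF normal_imp_subgroup[OF normal_vimage[OF R]] finV(2)]
      im[OF R.subset] kerR by (simp add: inf.absorb2)
  moreover have "card (kernel G H h) > 0"
    using finite_subset[OF kerR finV(2)] by (auto simp: card_gt_0_iff kernel_def)
  ultimately have card: "card (h ` V) \<le> B * card R"
    using V(4) by (simp add: mult.assoc[symmetric])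
  have "R \<subseteq> h ` V" using im[OF R.subset] V(2) by blast
  moreover have "h ` V \<noteq> R" using V(2) VG by blast
  moreover have "h ` V \<subseteq> K" using V(3) by blast
  ultimately show "\<exists>V. V \<lhd> H \<and> R \<subset> V \<and> V \<subseteq> K \<and> card V \<le> B * card R"
    using normal_image[OF V(1) surj] card by blast
qed

text \<open>Given \<open>R \<subset> K\<close>, intersect \<open>K\<close> with the kernels of the projections one after the other. At some
step \<open>i\<close> the intersection \<open>A\<close> is not inside \<open>R\<close> but the part of \<open>A\<close> killed by \<open>p i\<close> is. Then \<open>p i\<close>
preserves indices between \<open>A \<inter> R\<close> and \<open>A\<close>, so a refinement in \<open>H i\<close> pulls back to some \<open>V\<close>
between them, and \<open>R <#> V\<close> refines \<open>R \<subset> K\<close>.\<close>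

lemma (in group) refinable_subdirect:
  assumes fin: "finite (carrier G)" "finite I"
    and p: "\<And>i. i \<in> I \<Longrightarrow> group_hom G (H i) (p i)"
    and surj: "\<And>i. i \<in> I \<Longrightarrow> p i ` carrier G = carrier (H i)"
    and ref: "\<And>i. i \<in> I \<Longrightarrow> refinable B (H i)"
    and jointly_inj: "\<And>x. x \<in> carrier G \<Longrightarrow> (\<And>i. i \<in> I \<Longrightarrow> p i x = \<one>\<^bsub>H i\<^esub>) \<Longrightarrow> x = \<one>"
  shows "refinable B G"
  unfolding refinable_def
proof (intro allI impI)
  fix R K assume R: "R \<lhd> G" and K: "K \<lhd> G" and RK: "R \<subset> K"
  interpret R: normal R G by fact
  interpret K: normal K G by fact
  define M where "M J = {x \<in> K. \<forall>i\<in>J. p i x = \<one>\<^bsub>H i\<^esub>}" for J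
  have finG: "finite A" if A: "A \<subseteq> carrier G" for A
    using A fin(1) by (rule finite_subset)
  have M_normal: "M J \<lhd> G" if J: "J \<subseteq> I" for J
  proof (rule normal_invI)
    show "subgroup (M J) G"
    proof (rule subgroup.intro)
      show "M J \<subseteq> carrier G" using K.subset by (auto simp: M_def)
      show "\<one> \<in> M J"
        using J by (auto simp: M_def group_hom.hom_one[OF p])
      show "x \<otimes> y \<in> M J" if "x \<in> M J" "y \<in> M J" for x y
        using that J K.mem_carrier
        by (auto simp: M_def group_hom.hom_mult[OF p] group.is_monoid[OF group_hom.axioms(2)[OF p]]
            intro!: monoid.l_one)
      show "inv x \<in> M J" if x: "x \<in> M J" for x
        using x J K.mem_carrier
        by (auto simp: M_def group_hom.hom_inv[OF p] group_hom.axioms(2)[OF p] subset_iff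
            group.is_monoid monoid.inv_one)
    qed
    show "g \<otimes> x \<otimes> inv g \<in> M J" if g: "g \<in> carrier G" and x: "x \<in> M J" for g x
    proof -
      have xK: "x \<in> K" using x by (simp add: M_def)
      have "p i (g \<otimes> x \<otimes> inv g) = \<one>\<^bsub>H i\<^esub>" if i: "i \<in> J" for i
      proof -
        interpret p: group_hom G "H i" "p i" using i J by (intro p) blast
        have "p i x = \<one>\<^bsub>H i\<^esub>" using x i by (simp add: M_def)
        then show ?thesis using g K.mem_carrier[OF xK] by simp
      qed
      with xK g K.inv_op_closed2 show ?thesis by (simp add: M_def)
    qed
  qed
  have "M I \<subseteq> R"
  proof
    fix x assume "x \<in> M I"
    then have "x = \<one>" using K.mem_carrier jointly_inj[of x] by (simp add: M_def)
    then show "x \<in> R" by simp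
  qed
  \<comment> \<open>Impose the kernels one at a time; at some step the subgroup falls into \<open>R\<close>.\<close>
  moreover have "M {} = K" by (simp add: M_def)
  ultimately obtain J i where J: "insert i J \<subseteq> I" "M (insert i J) \<subseteq> R" "\<not> M J \<subseteq> R"
  proof -
    have "\<exists>i J. insert i J \<subseteq> I \<and> M (insert i J) \<subseteq> R \<and> \<not> M J \<subseteq> R"
      if "finite J'" "J' \<subseteq> I" "M J' \<subseteq> R" for J'
      using that
    proof (induction J' rule: finite_induct)
      case empty
      then show ?case using \<open>M {} = K\<close> RK by blast
    next
      case (insert i J)
      then show ?case by (cases "M J \<subseteq> R") blast+
    qed
    from this[OF fin(2) subset_refl \<open>M I \<subseteq> R\<close>] show thesis using that by blast
  qed
  define A where "A = M J"
  have A: "A \<lhd> G" using M_normal J(1) by (simp add: A_def)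
  interpret A: normal A G by fact
  have AK: "A \<subseteq> K" by (auto simp: A_def M_def)
  interpret p: group_hom G "H i" "p i" using J(1) by (intro p) simp
  have surj_i: "p i ` carrier G = carrier (H i)" using surj J(1) by simp
  have ker: "A \<inter> kernel G (H i) (p i) \<subseteq> R"
    using J(2) by (auto simp: A_def M_def kernel_def)
  have AR: "A \<inter> R \<lhd> G" using A R by (rule normal_subgroup_intersect)
  have ker_eq: "A \<inter> R \<inter> kernel G (H i) (p i) = A \<inter> kernel G (H i) (p i)"
    using ker by blast
  \<comment> \<open>Subgroups between \<open>A \<inter> R\<close> and \<open>A\<close> contain all of \<open>A\<close> that \<open>p i\<close> kills, so
    that indices between them survive in \<open>H i\<close>.\<close>
  have "p i ` (A \<inter> R) \<noteq> p i ` A"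
  proof
    assume eq: "p i ` (A \<inter> R) = p i ` A"
    have "card A = card (p i ` A) * card (A \<inter> kernel G (H i) (p i))"
      by (rule p.card_subgroup_hom[OF A.subgroup_axioms finG[OF A.subset]])
    also have "\<dots> = card (A \<inter> R)"
      using p.card_subgroup_hom[OF normal_imp_subgroup[OF AR]] finG[OF A.subset] eq ker_eq
      by simp
    finally have "A \<inter> R = A"
      by (intro card_subset_eq finG[OF A.subset]) auto
    with J(3) show False by (auto simp: A_def)
  qed
  then have pAR: "p i ` (A \<inter> R) \<subset> p i ` A" by blast
  have "refinable B (H i)" using ref J(1) by simp
  then obtain V' where V': "V' \<lhd> H i" "p i ` (A \<inter> R) \<subset> V'" "V' \<subseteq> p i ` A"
      "card V' \<le> B * card (p i ` (A \<inter> R))"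
    by (rule refinableD[OF _ p.normal_image[OF AR surj_i] p.normal_image[OF A surj_i] pAR])
  define V where "V = A \<inter> {x \<in> carrier G. p i x \<in> V'}"
  have V: "V \<lhd> G"
    unfolding V_def by (intro normal_subgroup_intersect A p.normal_vimage V'(1))
  interpret V: normal V G by fact
  have pV: "p i ` V = V'"
    using V'(3) A.subset unfolding V_def by blast
  have ARV: "A \<inter> R \<subseteq> V"
    using V'(2) A.subset unfolding V_def by blast
  have VA: "V \<subseteq> A" unfolding V_def by (rule Int_lower1)
  have VR: "V \<inter> R = A \<inter> R" using ARV VA by blast
  have "V \<inter> kernel G (H i) (p i) = A \<inter> kernel G (H i) (p i)"
    using ker ARV VA by blast
  then have "card V = card V' * card (A \<inter> kernel G (H i) (p i))"
    using p.card_subgroup_hom[OF V.subgroup_axioms finG[OF V.subset]] pV by simp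
  moreover have "card (A \<inter> R) = card (p i ` (A \<inter> R)) * card (A \<inter> kernel G (H i) (p i))"
    using p.card_subgroup_hom[OF normal_imp_subgroup[OF AR]] finG[OF A.subset] ker_eq by simp
  ultimately have cardV: "card V \<le> B * card (A \<inter> R)"
    using mult_le_mono1[OF V'(4), of "card (A \<inter> kernel G (H i) (p i))"]
    by (simp add: mult.assoc)
  have "card (R <#> V) * card (A \<inter> R) = card R * card V"
    using card_set_mult_normal[OF fin(1) R V] VR by simp
  also have "\<dots> \<le> B * card R * card (A \<inter> R)"
    using mult_le_mono2[OF cardV, of "card R"] by (simp add: ac_simps)
  finally have "card (R <#> V) * card (A \<inter> R) \<le> B * card R * card (A \<inter> R)" .
  moreover have "card (A \<inter> R) > 0"
  proof -
    have "\<one> \<in> A \<inter> R" by simp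
    then have "A \<inter> R \<noteq> {}" by blast
    then show ?thesis using finG[OF A.subset] by (simp add: card_gt_0_iff)
  qed
  ultimately have "card (R <#> V) \<le> B * card R" by simp
  moreover have "R \<subset> R <#> V"
  proof -
    note incl = subset_set_mult[OF R.subgroup_axioms V.subgroup_axioms]
    have "\<not> V \<subseteq> R"
    proof
      assume "V \<subseteq> R"
      then have "V = A \<inter> R" using VA ARV by blast
      with pV V'(2) show False by blast
    qed
    with incl show ?thesis by blast
  qed
  moreover have "R <#> V \<subseteq> K"
    using RK VA AK by (intro set_mult_subset K.subgroup_axioms) blast+
  moreover have "R <#> V \<lhd> G"
    using R V by (rule normal_subgroup_set_mult_closed)
  ultimately show "\<exists>V. V \<lhd> G \<and> R \<subset> V \<and> V \<subseteq> K \<and> card V \<le> B * card R" by blast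
qed

section \<open>Decompositions of the kernel and the Moebius function\<close>

definition normals_below :: "('a, 'b) monoid_scheme \<Rightarrow> 'a set \<Rightarrow> 'a set set" where
  "normals_below G K = {N. N \<lhd> G \<and> N \<subseteq> K}"

definition maximal_normals_below :: "('a, 'b) monoid_scheme \<Rightarrow> 'a set \<Rightarrow> 'a set set" where
  "maximal_normals_below G K =
     {R \<in> normals_below G K. R \<noteq> K \<and> (\<forall>V\<in>normals_below G K. R \<subseteq> V \<longrightarrow> V = R \<or> V = K)}"

text \<open>Such a list presents \<open>K\<close> as the product of the chief factors \<open>K / R\<close>, which is possible only if
\<open>K\<close> is a direct product of minimal normal subgroups of \<open>G\<close>. Otherwise there is none, and the
Moebius function vanishes.\<close>

definition chief_decompositions :: "('a, 'b) monoid_scheme \<Rightarrow> 'a set \<Rightarrow> 'a set list set" where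
  "chief_decompositions G K = decompositions (maximal_normals_below G K) K {\<one>\<^bsub>G\<^esub>}"

lemma (in group) finite_normals_below:
  assumes "finite (carrier G)"
  shows "finite (normals_below G K)"
proof (rule finite_subset)
  show "normals_below G K \<subseteq> Pow (carrier G)"
    by (auto simp: normals_below_def dest!: normal_imp_subgroup subgroup.subset)
qed (simp add: assms)

lemma (in group) finite_chief_decompositions:
  assumes "finite (carrier G)"
  shows "finite (chief_decompositions G K)"
proof -
  have "maximal_normals_below G K \<subseteq> normals_below G K"
    by (auto simp: maximal_normals_below_def)
  then show ?thesis
    unfolding chief_decompositions_def
    using finite_normals_below[OF assms] finite_subset finite_decompositions by metis
qed

lemma (in group) maximal_normal_above:
  assumes fin: "finite (carrier G)" and V: "V \<in> normals_below G K" "V \<noteq> K"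
  shows "\<exists>R\<in>maximal_normals_below G K. V \<subseteq> R"
proof -
  let ?S = "normals_below G K - {K}"
  have "finite ?S" "V \<in> ?S"
    using finite_normals_below[OF fin] V by simp_all
  then obtain R where R: "R \<in> ?S" "V \<subseteq> R" "\<forall>W\<in>?S. R \<subseteq> W \<longrightarrow> R = W"
    using finite_has_maximal2[of ?S V] by blast
  then have "R \<in> maximal_normals_below G K"
    unfolding maximal_normals_below_def by blast
  with R(2) show ?thesis by blast
qed

text \<open>The lattice of intermediate quotients is the family of normal subgroups inside the kernel with
inclusion reversed, so that the general bound applies to it.\<close>

lemma abs_mu_epi_le:
  assumes "finite_group G" "group F" "\<pi> \<in> epi G F"
  shows "\<bar>real_of_int (mu_epi G F \<pi>)\<bar>
           \<le> (\<Sum>Rs\<in>chief_decompositions G (kernel G F \<pi>). 1 / fact (length Rs))"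
proof -
  have G: "group G" and fin: "finite (carrier G)"
    using assms(1) by (auto simp: finite_group_def)
  interpret group_hom G F \<pi>
    using assms(2,3) G by (simp add: group_hom_def group_hom_axioms_def epi_def)
  let ?L = "quotient_lattice G F \<pi>" and ?K = "kernel G F \<pi>"
  have L: "carrier ?L = normals_below G ?K"
    using quotient_lattice_carrier[OF G assms(2,3)] by (simp add: normals_below_def)
  have le: "N' \<sqsubseteq>\<^bsub>?L\<^esub> N \<longleftrightarrow> N \<subseteq> N'" if "N \<in> carrier ?L" "N' \<in> carrier ?L" for N N'
    using that unfolding L normals_below_def by (simp add: quotient_lattice_le[OF G])
  have K: "?K \<in> carrier ?L" using normal_kernel by (simp add: L normals_below_def)
  interpret lat: lattice ?L using lattice_quotient_lattice[OF G assms(2,3)] .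
  have po: "partial_order ?L" by (rule lat.partial_order_axioms)
  have finL: "finite (carrier ?L)" using finite_quotient_lattice[OF assms(1)] .
  let ?mu = "\<lambda>V. real_of_int (moebius ?L ?K V)"
  interpret intersection_family "carrier ?L" ?K ?mu
  proof
    show "finite (carrier ?L)" by fact
    show "?K \<in> carrier ?L" by fact
    show "V \<subseteq> ?K" if "V \<in> carrier ?L" for V
      using that unfolding L normals_below_def by blast
    show "V \<inter> W \<in> carrier ?L" if "V \<in> carrier ?L" "W \<in> carrier ?L" for V W
      using that G.normal_subgroup_intersect[of V W] unfolding L normals_below_def by blast
    show "(\<Sum>W | W \<in> carrier ?L \<and> V \<subseteq> W. ?mu W) = (if V = ?K then 1 else 0)"
      if V: "V \<in> carrier ?L" for V
    proof (cases "V = ?K")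
      case True
      have "{W \<in> carrier ?L. V \<subseteq> W} = {?K}"
        using K unfolding True by (auto simp: L normals_below_def)
      moreover have "moebius ?L ?K ?K = 1"
        using po finL K lat.le_refl by (subst moebius.simps) simp
      ultimately show ?thesis using True by simp
    next
      case False
      let ?S = "{W \<in> carrier ?L. ?K \<sqsubseteq>\<^bsub>?L\<^esub> W \<and> W \<sqsubseteq>\<^bsub>?L\<^esub> V \<and> W \<noteq> V}"
      have VK: "?K \<sqsubseteq>\<^bsub>?L\<^esub> V" using le[OF V K] V by (simp add: L normals_below_def)
      have S: "{W \<in> carrier ?L. V \<subseteq> W} = insert V ?S"
        using V le K unfolding L normals_below_def by auto
      have "moebius ?L ?K V = - (\<Sum>W\<in>?S. moebius ?L ?K W)"
        using po finL K V VK False by (subst moebius.simps) simp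
      then have "?mu V = - (\<Sum>W\<in>?S. ?mu W)" by simp
      then show ?thesis
        unfolding S using False finL by simp
    qed
  qed
  have "\<bar>?mu {\<one>\<^bsub>G\<^esub>}\<bar>
      \<le> (\<Sum>Rs\<in>decompositions (maximal_normals_below G ?K) ?K {\<one>\<^bsub>G\<^esub>}. 1 / fact (length Rs))"
  proof (rule abs_mu_le_decompositions)
    show "maximal_normals_below G ?K \<subseteq> carrier ?L - {?K}"
      by (auto simp: L maximal_normals_below_def)
    show "\<exists>R\<in>maximal_normals_below G ?K. V \<subseteq> R" if "V \<in> carrier ?L" "V \<noteq> ?K" for V
      using that fin G.maximal_normal_above unfolding L by blast
    show "{\<one>\<^bsub>G\<^esub>} \<in> carrier ?L"
      using G.one_is_normal by (simp add: L normals_below_def kernel_def)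
  qed
  then show ?thesis
    by (simp add: mu_epi_def chief_decompositions_def)
qed

section \<open>Lengths of decompositions\<close>

text \<open>Because of this, the one-sided irredundancy of decompositions already makes each entry
complementary to the intersection of the entries after it.\<close>

lemma (in group) set_mult_maximal:
  assumes "R \<in> maximal_normals_below G K" "V \<in> normals_below G K" "K \<lhd> G" "\<not> V \<subseteq> R"
  shows "R <#> V = K"
proof -
  have R: "R \<lhd> G" "R \<subseteq> K" and V: "V \<lhd> G" "V \<subseteq> K"
    using assms(1,2) by (auto simp: maximal_normals_below_def normals_below_def)
  note incl = subset_set_mult[OF normal_imp_subgroup[OF R(1)] normal_imp_subgroup[OF V(1)]]
  have "R <#> V \<in> normals_below G K"
    using normal_subgroup_set_mult_closed[OF R(1) V(1)]
      set_mult_subset[OF normal_imp_subgroup[OF assms(3)] R(2) V(2)]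
    by (simp add: normals_below_def)
  moreover have "R <#> V \<noteq> R" using incl(2) assms(4) by blast
  ultimately show ?thesis
    using assms(1) incl(1) unfolding maximal_normals_below_def by blast
qed

lemma (in group) normals_below_foldr_Int:
  assumes "set Rs \<subseteq> normals_below G K" "K \<lhd> G"
  shows "foldr (\<inter>) Rs K \<in> normals_below G K"
  using assms(1)
proof (induction Rs)
  case Nil
  then show ?case using assms(2) by (simp add: normals_below_def)
next
  case (Cons R Rs)
  then have "R \<lhd> G" "R \<subseteq> K" "foldr (\<inter>) Rs K \<lhd> G"
    by (auto simp: normals_below_def)
  then show ?case
    using normal_subgroup_intersect by (auto simp: normals_below_def)
qed

text \<open>Intersecting with a maximal \<open>R\<close> divides the order by the index of \<open>R\<close> in \<open>K\<close>, which refinability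
bounds by \<open>B\<close>.\<close>

lemma (in group) card_le_power_length:
  assumes fin: "finite (carrier G)" and ref: "refinable B G" and K: "K \<lhd> G"
    and Rs: "irredundant (maximal_normals_below G K) K Rs"
  shows "card K \<le> B ^ length Rs * card (foldr (\<inter>) Rs K)"
  using Rs
proof (induction Rs)
  case Nil
  then show ?case by simp
next
  case (Cons R Rs)
  let ?I = "foldr (\<inter>) Rs K"
  have R: "R \<in> maximal_normals_below G K" and nI: "\<not> ?I \<subseteq> R"
    and irr: "irredundant (maximal_normals_below G K) K Rs"
    using Cons.prems by simp_all
  have I: "?I \<in> normals_below G K"
    using irredundant_distinct[OF irr] K
    by (intro normals_below_foldr_Int) (auto simp: maximal_normals_below_def)
  have RG: "R \<lhd> G" "R \<subset> K" and IG: "?I \<lhd> G"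
    using R I by (auto simp: maximal_normals_below_def normals_below_def)
  interpret R: normal R G by (rule RG(1))
  have "finite R" using R.subset fin by (rule finite_subset)
  then have Rpos: "card R > 0"
    using R.one_closed by (metis card_gt_0_iff empty_iff)
  obtain V where V: "V \<lhd> G" "R \<subset> V" "V \<subseteq> K" "card V \<le> B * card R"
    by (rule refinableD[OF ref RG(1) K RG(2)])
  then have "V = K"
    using R unfolding maximal_normals_below_def normals_below_def by blast
  have "card R * card ?I = card K * card (?I \<inter> R)"
    using card_set_mult_normal[OF fin RG(1) IG] set_mult_maximal[OF R I K nI] by simp
  also have "\<dots> \<le> B * card R * card (?I \<inter> R)"
    using V(4) \<open>V = K\<close> by (intro mult_le_mono1) simp
  finally have "card R * card ?I \<le> card R * (B * card (?I \<inter> R))"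
    by (simp add: ac_simps)
  then have "card ?I \<le> B * card (R \<inter> ?I)"
    using Rpos by (simp add: Int_commute)
  then have "B ^ length Rs * card ?I \<le> B ^ length Rs * (B * card (R \<inter> ?I))"
    by (rule mult_le_mono2)
  from le_trans[OF Cons.IH[OF irr] this] show ?case by (simp add: ac_simps)
qed

section \<open>Distributive elements\<close>

text \<open>In a modular lattice an element that distributes in one sense distributes in the dual sense.
For \<open>x = h a = k b\<close> with \<open>h, k \<in> H\<close>, \<open>a \<in> A\<close>, \<open>b \<in> B\<close> the hypothesis splits \<open>k\<inverse> h = b a\<inverse>\<close> as
\<open>u v\<close> with \<open>u \<in> H \<inter> B\<close> and \<open>v \<in> H \<inter> A\<close>; then \<open>v a = u\<inverse> b\<close> lies in \<open>A \<inter> B\<close> and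
\<open>x = (k u) (v a)\<close>.\<close>

lemma (in group) distrib_dual:
  assumes H: "subgroup H G" and A: "subgroup A G" and B: "subgroup B G"
    and distrib: "H \<inter> (B <#> A) \<subseteq> (H \<inter> B) <#> (H \<inter> A)"
  shows "H <#> (A \<inter> B) = (H <#> A) \<inter> (H <#> B)"
proof
  show "H <#> (A \<inter> B) \<subseteq> (H <#> A) \<inter> (H <#> B)"
    by (simp add: mono_set_mult)
  show "(H <#> A) \<inter> (H <#> B) \<subseteq> H <#> (A \<inter> B)"
  proof
    fix x assume x: "x \<in> (H <#> A) \<inter> (H <#> B)"
    interpret H: subgroup H G by fact
    interpret A: subgroup A G by fact
    interpret B: subgroup B G by fact
    obtain h a where ha: "h \<in> H" "a \<in> A" "x = h \<otimes> a"
      using x unfolding set_mult_def by blast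
    obtain k b where kb: "k \<in> H" "b \<in> B" "x = k \<otimes> b"
      using x unfolding set_mult_def by blast
    have cl: "h \<in> carrier G" "k \<in> carrier G" "a \<in> carrier G" "b \<in> carrier G"
      using ha kb by simp_all
    have eq: "inv k \<otimes> h = b \<otimes> inv a"
    proof -
      have "inv k \<otimes> h \<otimes> a = inv k \<otimes> (k \<otimes> b)"
        using ha(3) kb(3) cl by (simp add: m_assoc)
      also have "\<dots> = b" using cl by (simp add: m_assoc[symmetric])
      finally show ?thesis using cl by (metis inv_solve_right inv_closed m_closed)
    qed
    have "inv k \<otimes> h \<in> H" using ha kb by simp
    moreover have "b \<otimes> inv a \<in> B <#> A"
      using kb A.m_inv_closed[OF ha(2)] unfolding set_mult_def by blast
    ultimately have "inv k \<otimes> h \<in> (H \<inter> B) <#> (H \<inter> A)"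
      using eq distrib by (metis IntI subset_iff)
    then obtain u v where uv: "u \<in> H" "u \<in> B" "v \<in> H" "v \<in> A" "inv k \<otimes> h = u \<otimes> v"
      unfolding set_mult_def by blast
    have ucl: "u \<in> carrier G" "v \<in> carrier G" using uv by simp_all
    have "u \<otimes> (v \<otimes> a) = inv k \<otimes> h \<otimes> a"
      using uv(5) cl ucl by (simp add: m_assoc)
    also have "\<dots> = b" unfolding eq using cl by (simp add: m_assoc)
    finally have b: "u \<otimes> (v \<otimes> a) = b" .
    then have "v \<otimes> a = inv u \<otimes> b"
      using cl ucl by (metis inv_solve_left m_closed)
    moreover have "inv u \<otimes> b \<in> B" "v \<otimes> a \<in> A" using uv ha kb by simp_all
    ultimately have c: "v \<otimes> a \<in> A \<inter> B" by simp
    have "x = (k \<otimes> u) \<otimes> (v \<otimes> a)"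
      unfolding kb(3) b[symmetric] using cl ucl by (simp add: m_assoc)
    moreover have "k \<otimes> u \<in> H" using kb uv by simp
    ultimately show "x \<in> H <#> (A \<inter> B)"
      using c unfolding set_mult_def by blast
  qed
qed

text \<open>By the dual distributive law, multiplication by \<open>H\<close> passes through the intersection, and
\<open>H <#> R\<close> is \<open>R\<close> or \<open>K\<close> by maximality of \<open>R\<close>. For a decomposition, whose intersection is
trivial, this says that \<open>H\<close> is determined by the entries containing it.\<close>

lemma (in group) set_mult_foldr_Int:
  assumes H: "H \<in> normals_below G K" and K: "K \<lhd> G"
    and dist: "\<And>A B. A \<in> normals_below G K \<Longrightarrow> B \<in> normals_below G K \<Longrightarrow>
      H \<inter> (B <#> A) \<subseteq> (H \<inter> B) <#> (H \<inter> A)"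
    and Rs: "set Rs \<subseteq> maximal_normals_below G K"
  shows "H <#> foldr (\<inter>) Rs K = K \<inter> \<Inter>{R \<in> set Rs. H \<subseteq> R}"
  using Rs
proof (induction Rs)
  case Nil
  have "H \<lhd> G" "H \<subseteq> K" using H by (auto simp: normals_below_def)
  then have "H <#> K = K"
    using set_mult_subset[OF normal_imp_subgroup[OF K], of H K]
      subset_set_mult(2)[of H K] K by (auto dest!: normal_imp_subgroup)
  then show ?case by simp
next
  case (Cons R Rs)
  let ?I = "foldr (\<inter>) Rs K"
  have Rmax: "R \<in> maximal_normals_below G K" using Cons.prems by simp
  then have R: "R \<in> normals_below G K" by (simp add: maximal_normals_below_def)
  have I: "?I \<in> normals_below G K"
    using Cons.prems K by (intro normals_below_foldr_Int) (auto simp: maximal_normals_below_def)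
  have sub: "subgroup H G" "subgroup R G" "subgroup ?I G" "H \<lhd> G" "R \<lhd> G" "R \<subseteq> K"
    using H R I by (auto simp: normals_below_def normal_imp_subgroup)
  have HR: "H <#> R = (if H \<subseteq> R then R else K)"
  proof (cases "H \<subseteq> R")
    case True
    then show ?thesis
      using set_mult_subset[OF sub(2) True subset_refl] subset_set_mult(2)[OF sub(1,2)] by auto
  next
    case False
    then show ?thesis
      using set_mult_maximal[OF Rmax H K] commut_normal[OF sub(1) sub(5)] by simp
  qed
  have "H <#> (R \<inter> ?I) = (H <#> R) \<inter> (H <#> ?I)"
    by (rule distrib_dual[OF sub(1-3) dist[OF R I]])
  also have "H <#> ?I = K \<inter> \<Inter>{R \<in> set Rs. H \<subseteq> R}"
    using Cons.prems by (intro Cons.IH) simp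
  also have "(H <#> R) \<inter> \<dots> = K \<inter> \<Inter>{Q \<in> set (R # Rs). H \<subseteq> Q}"
    unfolding HR using sub(6) by auto
  finally show ?case by simp
qed

text \<open>Joins of quotients are intersections and meets are products of normal subgroups, so an element
counted by \<open>Z\<close> is determined by the set of entries of \<open>Rs\<close> that contain it.\<close>

lemma Z_epi_le:
  assumes "finite_group G" "group F" "\<pi> \<in> epi G F"
    and Rs: "Rs \<in> chief_decompositions G (kernel G F \<pi>)"
  shows "Z_epi G F \<pi> \<le> 2 ^ length Rs"
proof -
  have G: "group G" and fin: "finite (carrier G)"
    using assms(1) by (auto simp: finite_group_def)
  interpret group_hom G F \<pi>
    using assms(2,3) G by (simp add: group_hom_def group_hom_axioms_def epi_def)
  let ?L = "quotient_lattice G F \<pi>" and ?K = "kernel G F \<pi>"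
  have L: "carrier ?L = normals_below G ?K"
    using quotient_lattice_carrier[OF G assms(2,3)] by (simp add: normals_below_def)
  have le: "N' \<sqsubseteq>\<^bsub>?L\<^esub> N \<longleftrightarrow> N \<subseteq> N'" if "N \<in> carrier ?L" "N' \<in> carrier ?L" for N N'
    using that unfolding L normals_below_def by (simp add: quotient_lattice_le[OF G])
  interpret lat: lattice ?L using lattice_quotient_lattice[OF G assms(2,3)] .
  have join: "V \<squnion>\<^bsub>?L\<^esub> W = V \<inter> W" if VW: "V \<in> carrier ?L" "W \<in> carrier ?L" for V W
  proof (rule lat.le_antisym)
    have I: "V \<inter> W \<in> carrier ?L"
      using VW G.normal_subgroup_intersect[of V W] unfolding L normals_below_def by blast
    show "V \<squnion>\<^bsub>?L\<^esub> W \<sqsubseteq>\<^bsub>?L\<^esub> V \<inter> W"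
      using VW I by (intro lat.join_le) (auto simp: le)
    have J: "V \<squnion>\<^bsub>?L\<^esub> W \<in> carrier ?L" using VW by simp
    have "V \<squnion>\<^bsub>?L\<^esub> W \<subseteq> V" "V \<squnion>\<^bsub>?L\<^esub> W \<subseteq> W"
      using lat.join_left[OF VW] lat.join_right[OF VW] le[OF J] VW by simp_all
    then show "V \<inter> W \<sqsubseteq>\<^bsub>?L\<^esub> V \<squnion>\<^bsub>?L\<^esub> W"
      unfolding le[OF J I] by (rule Int_greatest)
    show "V \<squnion>\<^bsub>?L\<^esub> W \<in> carrier ?L" "V \<inter> W \<in> carrier ?L" by fact+
  qed
  have meet: "V \<sqinter>\<^bsub>?L\<^esub> W = V <#>\<^bsub>G\<^esub> W" if VW: "V \<in> carrier ?L" "W \<in> carrier ?L" for V W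
  proof (rule lat.le_antisym)
    have VW': "V \<lhd> G" "V \<subseteq> ?K" "W \<lhd> G" "W \<subseteq> ?K"
      using VW unfolding L normals_below_def by auto
    have M: "V <#>\<^bsub>G\<^esub> W \<in> carrier ?L"
      using G.normal_subgroup_set_mult_closed[OF VW'(1,3)]
        G.set_mult_subset[OF normal_imp_subgroup[OF normal_kernel] VW'(2,4)]
      by (simp add: L normals_below_def)
    note incl = G.subset_set_mult[OF normal_imp_subgroup[OF VW'(1)] normal_imp_subgroup[OF VW'(3)]]
    show "V <#>\<^bsub>G\<^esub> W \<sqsubseteq>\<^bsub>?L\<^esub> V \<sqinter>\<^bsub>?L\<^esub> W"
      using VW M incl by (intro lat.meet_le) (simp_all add: le)
    have J: "V \<sqinter>\<^bsub>?L\<^esub> W \<in> carrier ?L" using VW by simp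
    have "V \<subseteq> V \<sqinter>\<^bsub>?L\<^esub> W" "W \<subseteq> V \<sqinter>\<^bsub>?L\<^esub> W"
      using lat.meet_left[OF VW] lat.meet_right[OF VW] le[OF _ J] VW by simp_all
    moreover have "subgroup (V \<sqinter>\<^bsub>?L\<^esub> W) G"
      using J unfolding L normals_below_def by (simp add: normal_imp_subgroup)
    ultimately show "V \<sqinter>\<^bsub>?L\<^esub> W \<sqsubseteq>\<^bsub>?L\<^esub> V <#>\<^bsub>G\<^esub> W"
      unfolding le[OF M J] by (intro G.set_mult_subset)
    show "V \<sqinter>\<^bsub>?L\<^esub> W \<in> carrier ?L" "V <#>\<^bsub>G\<^esub> W \<in> carrier ?L" by fact+
  qed
  let ?D = "{H \<in> carrier ?L. \<forall>K1\<in>carrier ?L. \<forall>K2\<in>carrier ?L.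
       H \<squnion>\<^bsub>?L\<^esub> (K1 \<sqinter>\<^bsub>?L\<^esub> K2) = (H \<squnion>\<^bsub>?L\<^esub> K1) \<sqinter>\<^bsub>?L\<^esub> (H \<squnion>\<^bsub>?L\<^esub> K2)}"
  have irr: "set Rs \<subseteq> maximal_normals_below G ?K" and one: "foldr (\<inter>) Rs ?K = {\<one>\<^bsub>G\<^esub>}"
    using Rs irredundant_distinct by (auto simp: chief_decompositions_def decompositions_def)
  have D: "H = ?K \<inter> \<Inter>{R \<in> set Rs. H \<subseteq> R}" if H: "H \<in> ?D" for H
  proof -
    have HL: "H \<in> carrier ?L" using H by simp
    have "H \<inter> (B <#>\<^bsub>G\<^esub> A) \<subseteq> (H \<inter> B) <#>\<^bsub>G\<^esub> (H \<inter> A)"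
      if AB: "A \<in> normals_below G ?K" "B \<in> normals_below G ?K" for A B
    proof -
      have AB': "A \<in> carrier ?L" "B \<in> carrier ?L" using AB by (simp_all add: L)
      have cl: "B \<sqinter>\<^bsub>?L\<^esub> A \<in> carrier ?L" "H \<squnion>\<^bsub>?L\<^esub> B \<in> carrier ?L" "H \<squnion>\<^bsub>?L\<^esub> A \<in> carrier ?L"
        using AB' HL by simp_all
      have "H \<squnion>\<^bsub>?L\<^esub> (B \<sqinter>\<^bsub>?L\<^esub> A) = (H \<squnion>\<^bsub>?L\<^esub> B) \<sqinter>\<^bsub>?L\<^esub> (H \<squnion>\<^bsub>?L\<^esub> A)"
        using H AB' by simp
      moreover have "H \<squnion>\<^bsub>?L\<^esub> (B \<sqinter>\<^bsub>?L\<^esub> A) = H \<inter> (B <#>\<^bsub>G\<^esub> A)"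
        using join[OF HL cl(1)] meet[OF AB'(2,1)] by simp
      moreover have "(H \<squnion>\<^bsub>?L\<^esub> B) \<sqinter>\<^bsub>?L\<^esub> (H \<squnion>\<^bsub>?L\<^esub> A) = (H \<inter> B) <#>\<^bsub>G\<^esub> (H \<inter> A)"
        using meet[OF cl(2,3)] join[OF HL AB'(1)] join[OF HL AB'(2)] by simp
      ultimately show ?thesis by simp
    qed
    then have "H <#>\<^bsub>G\<^esub> foldr (\<inter>) Rs ?K = ?K \<inter> \<Inter>{R \<in> set Rs. H \<subseteq> R}"
      using HL irr by (intro G.set_mult_foldr_Int normal_kernel) (simp_all add: L)
    moreover have "subgroup H G"
      using HL unfolding L normals_below_def by (simp add: normal_imp_subgroup)
    then have "H <#>\<^bsub>G\<^esub> {\<one>\<^bsub>G\<^esub>} = H"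
      using G.coset_mult_one[OF subgroup.subset] by (simp add: r_coset_eq_set_mult)
    ultimately show ?thesis using one by simp
  qed
  have "inj_on (\<lambda>H. {R \<in> set Rs. H \<subseteq> R}) ?D"
  proof (rule inj_onI)
    fix H H' assume H: "H \<in> ?D" "H' \<in> ?D" "{R \<in> set Rs. H \<subseteq> R} = {R \<in> set Rs. H' \<subseteq> R}"
    have "H = ?K \<inter> \<Inter>{R \<in> set Rs. H \<subseteq> R}" by (rule D[OF H(1)])
    also have "\<dots> = ?K \<inter> \<Inter>{R \<in> set Rs. H' \<subseteq> R}" by (simp only: H(3))
    also have "\<dots> = H'" by (rule D[OF H(2), symmetric])
    finally show "H = H'" .
  qed
  then have "card ?D \<le> card (Pow (set Rs))"
    by (rule card_inj_on_le) auto
  also have "\<dots> \<le> 2 ^ length Rs"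
    by (simp add: card_Pow card_length)
  finally show ?thesis by (simp add: Z_epi_def Let_def)
qed

section \<open>Codes of quotients over the base\<close>

definition coset_label :: "('a, 'b) monoid_scheme \<Rightarrow> 'a set \<Rightarrow> 'a \<Rightarrow> nat" where
  "coset_label G R x = to_nat_on (rcosets\<^bsub>G\<^esub> R) (R #>\<^bsub>G\<^esub> x)"

text \<open>The multiplication table of \<open>G / R\<close>, written with natural numbers as elements, together with the
map to \<open>F\<close> induced by \<open>\<pi>\<close>. Equal codes give an isomorphism of quotients over \<open>F\<close>, and for
quotients of bounded order only finitely many codes occur.\<close>

definition quotient_code ::
    "('a, 'b) monoid_scheme \<Rightarrow> ('a \<Rightarrow> 'c) \<Rightarrow> 'a set \<Rightarrow> (nat \<times> nat \<times> nat \<times> 'c) set" where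
  "quotient_code G \<pi> R =
     (\<lambda>(x, y). (coset_label G R x, coset_label G R y, coset_label G R (x \<otimes>\<^bsub>G\<^esub> y), \<pi> x))
       ` (carrier G \<times> carrier G)"

lemma (in group) coset_label_eq_iff:
  assumes "finite (carrier G)" "x \<in> carrier G" "y \<in> carrier G"
  shows "coset_label G R x = coset_label G R y \<longleftrightarrow> R #> x = R #> y"
proof -
  have "rcosets R = (\<lambda>x. R #> x) ` carrier G" by (auto simp: RCOSETS_def)
  then have "finite (rcosets R)" "R #> x \<in> rcosets R" "R #> y \<in> rcosets R"
    using assms by auto
  then show ?thesis
    unfolding coset_label_def
    using to_nat_on_finite[of "rcosets R"] by (metis bij_betw_imp_inj_on inj_on_eq_iff)
qed

lemma (in group) coset_label_less:
  assumes "finite (carrier G)" "x \<in> carrier G"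
  shows "coset_label G R x < card (rcosets R)"
proof -
  have "rcosets R = (\<lambda>x. R #> x) ` carrier G" by (auto simp: RCOSETS_def)
  then have "finite (rcosets R)" "R #> x \<in> rcosets R"
    using assms by auto
  then show ?thesis
    unfolding coset_label_def
    using to_nat_on_finite[of "rcosets R"] by (metis bij_betwE lessThan_iff)
qed

abbreviation code_space :: "nat \<Rightarrow> 'c set \<Rightarrow> (nat \<times> nat \<times> nat \<times> 'c) set set" where
  "code_space q S \<equiv> Pow ({..<q} \<times> {..<q} \<times> {..<q} \<times> S)"

lemma (in group) quotient_code_mem:
  assumes "finite (carrier G)" "card (rcosets R) \<le> q" "\<pi> \<in> carrier G \<rightarrow> S"
  shows "quotient_code G \<pi> R \<in> code_space q S"
proof -
  have "coset_label G R x < q" if "x \<in> carrier G" for x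
    using coset_label_less[OF assms(1) that, of R] assms(2) by simp
  then show ?thesis
    using assms(3) by (auto simp: quotient_code_def)
qed

text \<open>Matching labels define the isomorphism of \<open>G / R\<close> with \<open>G' / R'\<close> that equality of the codes
provides: it is total, compatible with the maps to \<open>F\<close>, and multiplicative.\<close>

lemma quotient_code_transfer:
  assumes code: "quotient_code G \<pi> R = quotient_code G' \<pi>' R'"
    and G': "group_hom G' F \<pi>'" "finite (carrier G')" "R' \<lhd> G'" "R' \<subseteq> kernel G' F \<pi>'"
  shows "x \<in> carrier G \<Longrightarrow> \<exists>x'\<in>carrier G'. coset_label G R x = coset_label G' R' x'"
    and "x \<in> carrier G \<Longrightarrow> x' \<in> carrier G' \<Longrightarrow> coset_label G R x = coset_label G' R' x' \<Longrightarrow>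
      \<pi> x = \<pi>' x'"
    and "x \<in> carrier G \<Longrightarrow> x' \<in> carrier G' \<Longrightarrow> coset_label G R x = coset_label G' R' x' \<Longrightarrow>
      y \<in> carrier G \<Longrightarrow> y' \<in> carrier G' \<Longrightarrow> coset_label G R y = coset_label G' R' y' \<Longrightarrow>
      coset_label G R (x \<otimes>\<^bsub>G\<^esub> y) = coset_label G' R' (x' \<otimes>\<^bsub>G'\<^esub> y')"
proof -
  interpret p: group_hom G' F \<pi>' by fact
  interpret R': normal R' G' by fact
  let ?l = "coset_label G R" and ?l' = "coset_label G' R'"
  have row: "\<exists>u v. u \<in> carrier G' \<and> v \<in> carrier G' \<and> ?l x = ?l' u \<and> ?l y = ?l' v
      \<and> ?l (x \<otimes>\<^bsub>G\<^esub> y) = ?l' (u \<otimes>\<^bsub>G'\<^esub> v) \<and> \<pi> x = \<pi>' u"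
    if "x \<in> carrier G" "y \<in> carrier G" for x y
  proof -
    have "(?l x, ?l y, ?l (x \<otimes>\<^bsub>G\<^esub> y), \<pi> x) \<in> quotient_code G \<pi> R"
      using that unfolding quotient_code_def by force
    then show ?thesis
      unfolding code by (auto simp: quotient_code_def)
  qed
  show "\<exists>x'\<in>carrier G'. ?l x = ?l' x'" if "x \<in> carrier G"
    using row[OF that that] by blast
  show "\<pi> x = \<pi>' x'" if x: "x \<in> carrier G" "x' \<in> carrier G'" "?l x = ?l' x'"
  proof -
    obtain u where u: "u \<in> carrier G'" "?l x = ?l' u" "\<pi> x = \<pi>' u"
      using row[OF x(1) x(1)] by blast
    then have "R' #>\<^bsub>G'\<^esub> x' = R' #>\<^bsub>G'\<^esub> u"
      using p.G.coset_label_eq_iff[OF G'(2) x(2), of u R'] x(3) by simp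
    then have "x' \<in> R' #>\<^bsub>G'\<^esub> u"
      using p.G.rcos_self[OF x(2) R'.subgroup_axioms] by simp
    then obtain r where r: "r \<in> R'" "x' = r \<otimes>\<^bsub>G'\<^esub> u"
      unfolding r_coset_def by blast
    then have "\<pi>' r = \<one>\<^bsub>F\<^esub>" using G'(4) by (auto simp: kernel_def)
    then show ?thesis using r u by simp
  qed
  show "?l (x \<otimes>\<^bsub>G\<^esub> y) = ?l' (x' \<otimes>\<^bsub>G'\<^esub> y')"
    if x: "x \<in> carrier G" "x' \<in> carrier G'" "?l x = ?l' x'"
      and y: "y \<in> carrier G" "y' \<in> carrier G'" "?l y = ?l' y'"
  proof -
    obtain u v where uv: "u \<in> carrier G'" "v \<in> carrier G'" "?l x = ?l' u" "?l y = ?l' v"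
        "?l (x \<otimes>\<^bsub>G\<^esub> y) = ?l' (u \<otimes>\<^bsub>G'\<^esub> v)"
      using row[OF x(1) y(1)] by blast
    have "R' #>\<^bsub>G'\<^esub> x' = R' #>\<^bsub>G'\<^esub> u" "R' #>\<^bsub>G'\<^esub> y' = R' #>\<^bsub>G'\<^esub> v"
      using p.G.coset_label_eq_iff[OF G'(2), of _ _ R'] x y uv by simp_all
    then have "R' #>\<^bsub>G'\<^esub> (x' \<otimes>\<^bsub>G'\<^esub> y') = R' #>\<^bsub>G'\<^esub> (u \<otimes>\<^bsub>G'\<^esub> v)"
      using R'.rcos_sum x y uv by metis
    then show ?thesis
      using p.G.coset_label_eq_iff[OF G'(2), of "x' \<otimes>\<^bsub>G'\<^esub> y'" "u \<otimes>\<^bsub>G'\<^esub> v" R'] x y uv by simp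
  qed
qed

section \<open>A decomposed epimorphism is determined by its codes\<close>

text \<open>\<open>G\<close> maps onto the fibre product of the \<open>G / R\<^sub>i\<close> over \<open>H\<close>. The representative \<open>g\<close> found for the
tail is changed by an element of the intersection \<open>?I\<close> of the tail and the kernel, which does
not affect its classes there; as \<open>R <#> ?I\<close> is the whole kernel, this suffices to reach the class
of \<open>x\<close> modulo \<open>R\<close>.\<close>

lemma (in group_hom) chinese_remainder:
  assumes "irredundant (maximal_normals_below G (kernel G H h)) (kernel G H h) Rs"
    and "list_all2 (\<lambda>R x. x \<in> carrier G \<and> h x = v) Rs xs" and "v \<in> h ` carrier G"
  shows "\<exists>g\<in>carrier G. h g = v \<and> list_all2 (\<lambda>R x. R #> g = R #> x) Rs xs"
  using assms(2,1)
proof (induction Rs xs rule: list_all2_induct)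
  case Nil
  then show ?case using assms(3) by auto
next
  case (Cons R Rs x xs)
  let ?K = "kernel G H h"
  let ?I = "foldr (\<inter>) Rs ?K"
  have R: "R \<in> maximal_normals_below G ?K" "\<not> ?I \<subseteq> R"
    and irr: "irredundant (maximal_normals_below G ?K) ?K Rs"
    using Cons.prems by simp_all
  have Rs: "set Rs \<subseteq> normals_below G ?K"
    using irredundant_distinct[OF irr] by (auto simp: maximal_normals_below_def)
  then have I: "?I \<in> normals_below G ?K"
    by (intro G.normals_below_foldr_Int normal_kernel)
  obtain g where g: "g \<in> carrier G" "h g = v" "list_all2 (\<lambda>R x. R #> g = R #> x) Rs xs"
    using Cons.IH[OF irr] by blast
  have x: "x \<in> carrier G" "h x = v" using Cons.hyps by simp_all
  have "x \<otimes> inv g \<in> ?K"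
    using g x hom_closed[OF x(1)] by (simp add: kernel_def)
  then have "x \<otimes> inv g \<in> R <#> ?I"
    using G.set_mult_maximal[OF R(1) I normal_kernel R(2)] by simp
  then obtain r i where ri: "r \<in> R" "i \<in> ?I" "x \<otimes> inv g = r \<otimes> i"
    unfolding set_mult_def by blast
  have R': "R \<lhd> G" using R(1) by (auto simp: maximal_normals_below_def normals_below_def)
  interpret R: normal R G by fact
  have iK: "i \<in> ?K" by (rule subsetD[OF foldr_Int_subset ri(2)])
  then have i: "i \<in> carrier G" "h i = \<one>\<^bsub>H\<^esub>" by (simp_all add: kernel_def)
  have r: "r \<in> carrier G" using ri(1) by simp
  have "x = r \<otimes> (i \<otimes> g)"
  proof -
    have "x = x \<otimes> inv g \<otimes> g" using x g by (simp add: G.m_assoc)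
    then show ?thesis unfolding ri(3) using r i g by (simp add: G.m_assoc)
  qed
  then have "x \<in> R #> (i \<otimes> g)"
    using ri(1) unfolding r_coset_def by blast
  then have "R #> (i \<otimes> g) = R #> x"
    using i g by (intro G.repr_independence R.subgroup_axioms) simp_all
  moreover have "list_all2 (\<lambda>R x. R #> (i \<otimes> g) = R #> x) Rs xs"
    using g(3)
  proof (rule list.rel_mono_strong)
    fix Q y assume Q: "Q \<in> set Rs" and eq: "Q #> g = Q #> y"
    then interpret Q: normal Q G using Rs by (auto simp: normals_below_def)
    have "i \<in> Q" using foldr_Int_lower[OF Q, of ?K] ri(2) by blast
    then have "Q #> i = Q" by (rule Q.rcos_const[OF G.is_group])
    moreover have "Q #> (i \<otimes> g) = Q #> i #> g"
      using i g by (intro G.coset_mult_assoc[symmetric] Q.subset)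
    ultimately show "Q #> (i \<otimes> g) = Q #> y" using eq by simp
  qed
  moreover have "i \<otimes> g \<in> carrier G" "h (i \<otimes> g) = v"
    using i g hom_closed[OF g(1)] by simp_all
  ultimately show ?case by (intro bexI[of _ "i \<otimes> g"]) simp_all
qed

text \<open>The relation that turns out to be the graph of an isomorphism: \<open>x\<close> and \<open>x'\<close> have the same
components in the two fibre products.\<close>

definition corresponds ::
    "('a, 'b) monoid_scheme \<Rightarrow> ('a \<Rightarrow> 'f) \<Rightarrow> 'a set list \<Rightarrow>
     ('c, 'd) monoid_scheme \<Rightarrow> ('c \<Rightarrow> 'f) \<Rightarrow> 'c set list \<Rightarrow> 'a \<Rightarrow> 'c \<Rightarrow> bool" where
  "corresponds G \<pi> Rs G' \<pi>' Rs' x x' \<longleftrightarrow> x \<in> carrier G \<and> x' \<in> carrier G' \<and> \<pi> x = \<pi>' x' \<and>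
     (\<forall>i<length Rs. coset_label G (Rs ! i) x = coset_label G' (Rs' ! i) x')"

text \<open>All hypotheses but \<open>image_subset\<close> are symmetric in the two groups, and for epimorphisms this one
is as well. So the locale is interpreted in both directions below.\<close>

locale coded_decompositions =
  h: group_hom G F \<pi> + h': group_hom G' F \<pi>'
  for G (structure) and G' and F and \<pi> and \<pi>' +
  fixes Rs Rs'
  assumes finite_G: "finite (carrier G)" and finite_G': "finite (carrier G')"
    and image_subset: "\<pi> ` carrier G \<subseteq> \<pi>' ` carrier G'"
    and Rs: "Rs \<in> chief_decompositions G (kernel G F \<pi>)"
    and Rs': "Rs' \<in> chief_decompositions G' (kernel G' F \<pi>')"
    and codes: "map (quotient_code G \<pi>) Rs = map (quotient_code G' \<pi>') Rs'"
begin

lemma length_eq: "length Rs = length Rs'"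
  using arg_cong[OF codes, of length] by simp

lemma code_nth: "i < length Rs \<Longrightarrow> quotient_code G \<pi> (Rs ! i) = quotient_code G' \<pi>' (Rs' ! i)"
  using codes length_eq by (metis nth_map)

lemma irredundant': "irredundant (maximal_normals_below G' (kernel G' F \<pi>')) (kernel G' F \<pi>') Rs'"
  using Rs' by (simp add: chief_decompositions_def decompositions_def)

lemma factor': "i < length Rs \<Longrightarrow> Rs' ! i \<lhd> G' \<and> Rs' ! i \<subseteq> kernel G' F \<pi>'"
proof -
  assume "i < length Rs"
  then have "Rs' ! i \<in> maximal_normals_below G' (kernel G' F \<pi>')"
    using irredundant_distinct[OF irredundant'] length_eq nth_mem[of i Rs'] by auto
  then show ?thesis by (simp add: maximal_normals_below_def normals_below_def)
qed

text \<open>The components of \<open>x\<close>, transported along the equal codes, have a common lift by the Chinese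
remainder theorem.\<close>

lemma corresponds_exists:
  assumes x: "x \<in> carrier G"
  shows "\<exists>x'. corresponds G \<pi> Rs G' \<pi>' Rs' x x'"
proof -
  have "\<forall>i<length Rs. \<exists>y. y \<in> carrier G' \<and> coset_label G (Rs ! i) x = coset_label G' (Rs' ! i) y"
    using quotient_code_transfer(1)[OF code_nth h'.group_hom_axioms finite_G'] factor' x by blast
  then obtain ys where ys: "length ys = length Rs"
    "\<And>i. i < length Rs \<Longrightarrow> ys ! i \<in> carrier G'"
    "\<And>i. i < length Rs \<Longrightarrow> coset_label G (Rs ! i) x = coset_label G' (Rs' ! i) (ys ! i)"
    unfolding Skolem_list_nth by blast
  have "\<pi>' (ys ! i) = \<pi> x" if i: "i < length Rs" for i
    using quotient_code_transfer(2)[OF code_nth[OF i] h'.group_hom_axioms finite_G' _ _ x ys(2)[OF i]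
        ys(3)[OF i]] factor'[OF i] by simp
  then have "list_all2 (\<lambda>R y. y \<in> carrier G' \<and> \<pi>' y = \<pi> x) Rs' ys"
    using ys(1,2) length_eq by (simp add: list_all2_conv_all_nth)
  moreover have "\<pi> x \<in> \<pi>' ` carrier G'" using image_subset x by blast
  ultimately obtain g where g: "g \<in> carrier G'" "\<pi>' g = \<pi> x"
    "list_all2 (\<lambda>R y. R #>\<^bsub>G'\<^esub> g = R #>\<^bsub>G'\<^esub> y) Rs' ys"
    using h'.chinese_remainder[OF irredundant'] by blast
  have "coset_label G (Rs ! i) x = coset_label G' (Rs' ! i) g" if i: "i < length Rs" for i
  proof -
    have "Rs' ! i #>\<^bsub>G'\<^esub> g = Rs' ! i #>\<^bsub>G'\<^esub> (ys ! i)"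
      using g(3) i length_eq by (simp add: list_all2_conv_all_nth)
    then show ?thesis
      using h'.G.coset_label_eq_iff[OF finite_G' g(1) ys(2)[OF i], of "Rs' ! i"] ys(3)[OF i] by simp
  qed
  with x g show ?thesis by (auto simp: corresponds_def)
qed

text \<open>Two candidates differ by an element of all \<open>Rs' ! i\<close> and of the kernel, whose intersection is
trivial.\<close>

lemma corresponds_unique:
  assumes "corresponds G \<pi> Rs G' \<pi>' Rs' x y" "corresponds G \<pi> Rs G' \<pi>' Rs' x z"
  shows "y = z"
proof -
  have yz: "y \<in> carrier G'" "z \<in> carrier G'" "\<pi>' y = \<pi>' z"
    using assms by (simp_all add: corresponds_def)
  let ?d = "y \<otimes>\<^bsub>G'\<^esub> inv\<^bsub>G'\<^esub> z"
  have "?d \<in> R" if R: "R \<in> set Rs'" for R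
  proof -
    obtain i where i: "i < length Rs" "R = Rs' ! i"
      using R unfolding in_set_conv_nth length_eq by metis
    interpret R: normal R G' using factor'[OF i(1)] i(2) by simp
    have "coset_label G' R y = coset_label G' R z"
      using assms i by (simp add: corresponds_def)
    then have "R #>\<^bsub>G'\<^esub> y = R #>\<^bsub>G'\<^esub> z"
      using h'.G.coset_label_eq_iff[OF finite_G' yz(1,2), of R] by simp
    then have "y \<in> R #>\<^bsub>G'\<^esub> z"
      using h'.G.rcos_self[OF yz(1) R.subgroup_axioms] by simp
    then show ?thesis using R.rcos_module_imp[OF h'.G.is_group yz(2)] by simp
  qed
  moreover have "?d \<in> kernel G' F \<pi>'"
    using yz by (simp add: kernel_def)
  ultimately have "?d \<in> foldr (\<inter>) Rs' (kernel G' F \<pi>')"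
    by (induction Rs') auto
  then have "?d = \<one>\<^bsub>G'\<^esub>"
    using Rs' by (simp add: chief_decompositions_def decompositions_def)
  then show ?thesis
    using yz h'.G.inv_solve_right'[of "\<one>\<^bsub>G'\<^esub>" y z] by simp
qed

lemma corresponds_mult:
  assumes "corresponds G \<pi> Rs G' \<pi>' Rs' x x'" "corresponds G \<pi> Rs G' \<pi>' Rs' y y'"
  shows "corresponds G \<pi> Rs G' \<pi>' Rs' (x \<otimes> y) (x' \<otimes>\<^bsub>G'\<^esub> y')"
  unfolding corresponds_def
proof (intro conjI allI impI)
  have xy: "x \<in> carrier G" "x' \<in> carrier G'" "\<pi> x = \<pi>' x'"
    "y \<in> carrier G" "y' \<in> carrier G'" "\<pi> y = \<pi>' y'"
    using assms by (simp_all add: corresponds_def)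
  then show "x \<otimes> y \<in> carrier G" "x' \<otimes>\<^bsub>G'\<^esub> y' \<in> carrier G'" "\<pi> (x \<otimes> y) = \<pi>' (x' \<otimes>\<^bsub>G'\<^esub> y')"
    by simp_all
  fix i assume i: "i < length Rs"
  have "coset_label G (Rs ! i) x = coset_label G' (Rs' ! i) x'"
    "coset_label G (Rs ! i) y = coset_label G' (Rs' ! i) y'"
    using assms i by (simp_all add: corresponds_def)
  then show "coset_label G (Rs ! i) (x \<otimes> y) = coset_label G' (Rs' ! i) (x' \<otimes>\<^bsub>G'\<^esub> y')"
    using quotient_code_transfer(3)[OF code_nth[OF i] h'.group_hom_axioms finite_G'] factor'[OF i] xy
    by blast
qed

end

lemma corresponds_sym:
  assumes "length Rs = length Rs'"
  shows "corresponds G \<pi> Rs G' \<pi>' Rs' x x' \<longleftrightarrow> corresponds G' \<pi>' Rs' G \<pi> Rs x' x"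
  using assms by (auto simp: corresponds_def)

text \<open>Both \<open>G\<close> and \<open>G'\<close> are the fibre product of their quotients over \<open>F\<close>, and equality of the codes
identifies these quotients one by one.\<close>

theorem chief_decomposition_rigid:
  assumes G: "finite_group G" "\<pi> \<in> epi G F"
    and G': "finite_group G'" "\<pi>' \<in> epi G' F" and F: "group F"
    and Rs: "Rs \<in> chief_decompositions G (kernel G F \<pi>)"
    and Rs': "Rs' \<in> chief_decompositions G' (kernel G' F \<pi>')"
    and codes: "map (quotient_code G \<pi>) Rs = map (quotient_code G' \<pi>') Rs'"
  shows "\<exists>\<alpha>\<in>iso G G' \<inter> extensional (carrier G).
           (\<forall>x\<in>carrier G. \<pi>' (\<alpha> x) = \<pi> x) \<and> Rs' = map ((`) \<alpha>) Rs"
proof -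
  interpret h: group_hom G F \<pi>
    using G F by (simp add: finite_group_def group_hom_def group_hom_axioms_def epi_def)
  interpret h': group_hom G' F \<pi>'
    using G' F by (simp add: finite_group_def group_hom_def group_hom_axioms_def epi_def)
  interpret c: coded_decompositions G G' F \<pi> \<pi>' Rs Rs'
    using assms by unfold_locales (auto simp: finite_group_def epi_def)
  interpret c': coded_decompositions G' G F \<pi>' \<pi> Rs' Rs
    using assms by unfold_locales (auto simp: finite_group_def epi_def)
  let ?R = "corresponds G \<pi> Rs G' \<pi>' Rs'"
  note sym = corresponds_sym[OF c.length_eq, of G \<pi> G' \<pi>']
  define \<alpha> where "\<alpha> = (\<lambda>x\<in>carrier G. SOME x'. ?R x x')"
  have R: "?R x (\<alpha> x)" if x: "x \<in> carrier G" for x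
    using someI_ex[OF c.corresponds_exists[OF x]] x by (simp add: \<alpha>_def)
  have \<alpha>: "\<alpha> x = x'" if "?R x x'" for x x'
  proof (rule c.corresponds_unique[OF R that])
    show "x \<in> carrier G" using that by (simp add: corresponds_def)
  qed
  have closed: "\<alpha> x \<in> carrier G'" and over: "\<pi>' (\<alpha> x) = \<pi> x" if "x \<in> carrier G" for x
    using R[OF that] by (simp_all add: corresponds_def)
  have hom: "\<alpha> \<in> hom G G'"
  proof (rule homI)
    fix x y assume "x \<in> carrier G" "y \<in> carrier G"
    then show "\<alpha> (x \<otimes>\<^bsub>G\<^esub> y) = \<alpha> x \<otimes>\<^bsub>G'\<^esub> \<alpha> y"
      by (intro \<alpha> c.corresponds_mult R)
  qed (rule closed)
  have inj: "inj_on \<alpha> (carrier G)"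
  proof (rule inj_onI)
    fix x y assume xy: "x \<in> carrier G" "y \<in> carrier G" "\<alpha> x = \<alpha> y"
    show "x = y"
      using R[OF xy(1)] R[OF xy(2)] unfolding xy(3) sym by (rule c'.corresponds_unique)
  qed
  have surj: "\<alpha> ` carrier G = carrier G'"
  proof
    show "\<alpha> ` carrier G \<subseteq> carrier G'" using closed by blast
    show "carrier G' \<subseteq> \<alpha> ` carrier G"
    proof
      fix x' assume "x' \<in> carrier G'"
      then obtain x where "?R x x'" using c'.corresponds_exists unfolding sym by blast
      then have "\<alpha> x = x'" "x \<in> carrier G" by (rule \<alpha>) (use \<open>?R x x'\<close> in \<open>simp add: corresponds_def\<close>)
      then show "x' \<in> \<alpha> ` carrier G" by blast
    qed
  qed
  have mem: "x \<in> Rs ! i \<longleftrightarrow> \<alpha> x \<in> Rs' ! i" if i: "i < length Rs" and x: "x \<in> carrier G" for i x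
  proof -
    interpret \<alpha>: group_hom G G' \<alpha> using hom by unfold_locales
    interpret N: normal "Rs ! i" G using c'.factor' i c.length_eq by simp
    interpret N': normal "Rs' ! i" G' using c.factor' i by simp
    have lab: "coset_label G (Rs ! i) x = coset_label G' (Rs' ! i) (\<alpha> x)"
      "coset_label G (Rs ! i) \<one>\<^bsub>G\<^esub> = coset_label G' (Rs' ! i) \<one>\<^bsub>G'\<^esub>"
      using R[OF x] R[of "\<one>\<^bsub>G\<^esub>"] i by (simp_all add: corresponds_def)
    have "x \<in> Rs ! i \<longleftrightarrow> Rs ! i #>\<^bsub>G\<^esub> x = Rs ! i #>\<^bsub>G\<^esub> \<one>\<^bsub>G\<^esub>"
      using h.G.coset_join1[OF _ x N.subgroup_axioms] h.G.coset_join2[OF x N.subgroup_axioms]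
        h.G.coset_mult_one[OF N.subset] by auto
    also have "\<dots> \<longleftrightarrow> coset_label G (Rs ! i) x = coset_label G (Rs ! i) \<one>\<^bsub>G\<^esub>"
      by (rule h.G.coset_label_eq_iff[OF c.finite_G x h.G.one_closed, symmetric])
    also have "\<dots> \<longleftrightarrow> coset_label G' (Rs' ! i) (\<alpha> x) = coset_label G' (Rs' ! i) \<one>\<^bsub>G'\<^esub>"
      unfolding lab ..
    also have "\<dots> \<longleftrightarrow> Rs' ! i #>\<^bsub>G'\<^esub> \<alpha> x = Rs' ! i #>\<^bsub>G'\<^esub> \<one>\<^bsub>G'\<^esub>"
      by (rule h'.G.coset_label_eq_iff[OF c'.finite_G closed[OF x] h'.G.one_closed])
    also have "\<dots> \<longleftrightarrow> \<alpha> x \<in> Rs' ! i"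
      using h'.G.coset_join1[OF _ closed[OF x] N'.subgroup_axioms]
        h'.G.coset_join2[OF closed[OF x] N'.subgroup_axioms] h'.G.coset_mult_one[OF N'.subset] by auto
    finally show ?thesis .
  qed
  have "Rs' = map ((`) \<alpha>) Rs"
  proof (rule nth_equalityI)
    fix i assume "i < length Rs'"
    then have i: "i < length Rs" using c.length_eq by simp
    have sub: "Rs ! i \<subseteq> carrier G" "Rs' ! i \<subseteq> carrier G'"
      using c.factor'[OF i] c'.factor'[of i] i c.length_eq
      by (auto dest!: normal_imp_subgroup subgroup.subset)
    have "\<alpha> ` (Rs ! i) = Rs' ! i"
    proof
      show "\<alpha> ` (Rs ! i) \<subseteq> Rs' ! i" using mem[OF i] sub(1) by blast
      show "Rs' ! i \<subseteq> \<alpha> ` (Rs ! i)"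
      proof
        fix y assume y: "y \<in> Rs' ! i"
        then have "y \<in> \<alpha> ` carrier G" using sub(2) surj by blast
        then obtain x where "x \<in> carrier G" "y = \<alpha> x" by blast
        with mem[OF i] y show "y \<in> \<alpha> ` (Rs ! i)" by blast
      qed
    qed
    then show "Rs' ! i = map ((`) \<alpha>) Rs ! i" using i by simp
  qed (simp add: c.length_eq)
  moreover have "\<alpha> \<in> iso G G'" using hom inj surj by (simp add: iso_def bij_betw_def)
  moreover have "\<alpha> \<in> extensional (carrier G)" by (simp add: \<alpha>_def)
  ultimately show ?thesis using over by blast
qed

section \<open>Isomorphism classes and levels\<close>

lemma finite_group_nat_copy:
  assumes "finite_group G"
  obtains H :: "nat monoid" where "finite_group H" "H \<cong> G"
proof -
  interpret group G using assms by (simp add: finite_group_def)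
  obtain f :: "_ \<Rightarrow> nat" where f: "bij_betw f (carrier G) {0..<card (carrier G)}"
    using ex_bij_betw_finite_nat assms unfolding finite_group_def by blast
  then have "inj_on f (carrier G)" by (rule bij_betw_imp_inj_on)
  then have iso: "f \<in> iso G (image_group f G)"
    by (rule inj_imp_image_group_iso)
  then have "group (image_group f G)"
    using iso_imp_img_group inj_imp_image_group_is_group \<open>inj_on f (carrier G)\<close> by blast
  moreover have "finite (carrier (image_group f G))"
    using assms by (simp add: image_group_carrier finite_group_def)
  moreover have "image_group f G \<cong> G"
    using iso by (intro iso_sym is_isoI)
  ultimately show thesis using that[of "image_group f G"] by (simp add: finite_group_def)
qed

lemma iso_class_eq:
  assumes "H \<in> iso_class G" "finite_group G"
  shows "iso_class H = iso_class G"
proof -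
  have H: "group H" "H \<cong> G" using assms(1) by (auto simp: iso_class_def finite_group_def)
  have "G \<cong> H" using H by (rule group.iso_sym)
  then have "K \<cong> H \<longleftrightarrow> K \<cong> G" for K :: "nat monoid"
    using iso_trans[of K H G] iso_trans[of K G H] H(2) \<open>G \<cong> H\<close> by blast
  then show ?thesis by (simp add: iso_class_def)
qed

lemma iso_class_in_iso_classes:
  assumes "finite_group G"
  shows "iso_class G \<in> iso_classes"
proof -
  obtain H :: "nat monoid" where H: "finite_group H" "H \<cong> G"
    using finite_group_nat_copy[OF assms] .
  then have "iso_class H = iso_class G"
    by (intro iso_class_eq assms) (simp add: iso_class_def)
  with H(1) show ?thesis unfolding iso_classes_def by auto
qed

lemma representative_iso_classes:
  assumes "\<C> \<in> iso_classes"
  shows "finite_group (representative \<C>)" "\<C> = iso_class (representative \<C>)"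
proof -
  obtain G :: "nat monoid" where G: "finite_group G" "\<C> = iso_class G"
    using assms unfolding iso_classes_def by blast
  then have "G \<in> \<C>" by (simp add: iso_class_def iso_refl)
  then have R: "representative \<C> \<in> \<C>" unfolding representative_def by (rule someI)
  then show "finite_group (representative \<C>)" using G(2) by (simp add: iso_class_def)
  show "\<C> = iso_class (representative \<C>)"
    using iso_class_eq[OF R[unfolded G(2)] G(1)] G(2) by simp
qed

lemma representative_mem:
  assumes "\<C> \<in> iso_classes"
  shows "representative \<C> \<in> \<C>"
proof -
  have "representative \<C> \<in> iso_class (representative \<C>)"
    using representative_iso_classes(1)[OF assms] by (simp add: iso_class_def iso_refl)
  then show ?thesis using representative_iso_classes(2)[OF assms] by simp
qed

lemma refinable_iso:
  assumes "finite_group G" "finite_group H" "H \<cong> G" "refinable B G"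
  shows "refinable B H"
proof -
  have gr: "group G" "group H" using assms by (auto simp: finite_group_def)
  have "G \<cong> H" using gr(2) assms(3) by (rule group.iso_sym)
  then obtain h where h: "h \<in> iso G H" unfolding is_iso_def by blast
  then interpret group_hom G H h
    using gr by (simp add: group_hom_def group_hom_axioms_def iso_def)
  show ?thesis
    using assms(1,4) h by (intro refinable_image) (auto simp: finite_group_def iso_def bij_betw_def)
qed

lemma refinable_iso_class:
  assumes "finite_group G" "refinable B G"
  shows "iso_class G \<in> iso_classes \<and> (\<forall>H\<in>iso_class G. refinable B H)"
proof (intro conjI ballI iso_class_in_iso_classes assms(1))
  fix H assume "H \<in> iso_class G"
  then have "finite_group H" "H \<cong> G" by (simp_all add: iso_class_def)
  then show "refinable B H" using refinable_iso[OF assms(1) _ _ assms(2)] by blast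
qed

text \<open>The constant \<open>B\<close> exceeds the orders of all generators, and refinability passes to quotients and
subdirect products without changing it.\<close>

lemma generated_level_refinable:
  assumes S: "finite S" "S \<subseteq> iso_classes"
  shows "\<exists>B. \<forall>\<C>\<in>generated_level S. \<C> \<in> iso_classes \<and> (\<forall>G\<in>\<C>. refinable B G)"
proof -
  define B where "B = 1 + (\<Sum>\<C>\<in>S. order (representative \<C>))"
  have "\<C> \<in> iso_classes \<and> (\<forall>G\<in>\<C>. refinable B G)" if "\<C> \<in> generated_level S" for \<C>
    using that
  proof (induction rule: generated_level.induct)
    case (generator \<C>)
    then have C: "\<C> \<in> iso_classes" using S(2) by blast
    note G = representative_iso_classes[OF C]
    have "order (representative \<C>) \<le> B"
      unfolding B_def using member_le_sum[OF generator, of "\<lambda>\<C>. order (representative \<C>)"] S(1) by simp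
    then have "refinable B (representative \<C>)"
      using G(1) by (intro group.refinable_order) (auto simp: finite_group_def)
    then have "iso_class (representative \<C>) \<in> iso_classes \<and> (\<forall>H\<in>iso_class (representative \<C>). refinable B H)"
      by (rule refinable_iso_class[OF G(1)])
    then show ?case unfolding G(2)[symmetric] .
  next
    case trivial
    have "refinable B (singleton_group (0::nat))"
      by (rule group.refinable_order) (simp_all add: order_def B_def)
    moreover have "finite_group (singleton_group (0::nat))" by (simp add: finite_group_def)
    ultimately show ?case by (intro refinable_iso_class)
  next
    case (quotient G N)
    interpret N: normal N G by (rule quotient.hyps(3))
    interpret q: group_hom G "G Mod N" "\<lambda>x. N #>\<^bsub>G\<^esub> x"
      by (intro group_hom.intro group_hom_axioms.intro N.is_group N.factorgroup_is_group
          N.r_coset_hom_Mod)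
    have fin: "finite (carrier G)" using quotient.hyps(1) by (simp add: finite_group_def)
    have surj: "(\<lambda>x. N #>\<^bsub>G\<^esub> x) ` carrier G = carrier (G Mod N)"
      by (auto simp: carrier_FactGroup)
    have "finite_group (G Mod N)"
      using fin N.factorgroup_is_group surj by (metis finite_group_def finite_imageI)
    moreover have "G \<in> iso_class G"
      using quotient.hyps(1) by (simp add: iso_class_def iso_refl)
    then have "refinable B (G Mod N)"
      using quotient.IH fin surj by (intro q.refinable_image) auto
    ultimately show ?case by (intro refinable_iso_class)
  next
    case (subdirect I H P)
    let ?D = "(product_group I H)\<lparr>carrier := P\<rparr>"
    have H: "group (H i)" "finite (carrier (H i))" "refinable B (H i)" if i: "i \<in> I" for i
    proof -
      have fg: "finite_group (H i)" using subdirect.hyps(2) i .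
      then show "group (H i)" "finite (carrier (H i))" by (simp_all add: finite_group_def)
      have "H i \<in> iso_class (H i)" using fg by (simp add: iso_class_def iso_refl)
      then show "refinable B (H i)" using subdirect.IH[OF i] by blast
    qed
    have P: "subgroup P (product_group I H)" "\<And>i. i \<in> I \<Longrightarrow> (\<lambda>x. x i) ` P = carrier (H i)"
      using subdirect.hyps(4) by (auto simp: subdirect_product_def)
    have grP: "group (product_group I H)" using H(1) by simp
    have gr: "group ?D" using P(1) grP by (rule subgroup.subgroup_is_group)
    have PE: "P \<subseteq> (\<Pi>\<^sub>E i\<in>I. carrier (H i))" using subgroup.subset[OF P(1)] by simp
    then have fin: "finite P"
      by (rule finite_subset) (intro finite_PiE subdirect.hyps(1) H(2))
    have "refinable B ?D"
    proof (rule group.refinable_subdirect[OF gr _ subdirect.hyps(1), where H = H and p = "\<lambda>i x. x i"])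
      show "finite (carrier ?D)" using fin by simp
      show "group_hom ?D (H i) (\<lambda>x. x i)" if i: "i \<in> I" for i
      proof (intro group_hom.intro group_hom_axioms.intro gr H(1)[OF i] homI)
        show "x i \<in> carrier (H i)" if "x \<in> carrier ?D" for x
          using that PE i by (auto simp: PiE_iff)
      qed (use i in simp)
      show "(\<lambda>x. x i) ` carrier ?D = carrier (H i)" if "i \<in> I" for i
        using P(2)[OF that] by simp
      show "refinable B (H i)" if "i \<in> I" for i using H(3)[OF that] .
      show "x = \<one>\<^bsub>?D\<^esub>" if x: "x \<in> carrier ?D" "\<And>i. i \<in> I \<Longrightarrow> x i = \<one>\<^bsub>H i\<^esub>" for x
      proof -
        have "x \<in> extensional I" using x(1) PE by (auto simp: PiE_def)
        moreover have "(\<lambda>i\<in>I. \<one>\<^bsub>H i\<^esub>) \<in> extensional I" by simp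
        ultimately have "x = (\<lambda>i\<in>I. \<one>\<^bsub>H i\<^esub>)"
          by (rule extensionalityI) (simp add: x(2))
        then show ?thesis by simp
      qed
    qed
    moreover have "finite_group ?D" using gr fin by (simp add: finite_group_def)
    ultimately show ?case by (intro refinable_iso_class)
  qed
  then show ?thesis by blast
qed

section \<open>Counting decomposed epimorphisms\<close>

lemma finite_auto:
  assumes "finite (carrier G)"
  shows "finite (auto G)"
proof (rule finite_subset)
  show "auto G \<subseteq> carrier G \<rightarrow>\<^sub>E carrier G"
    by (auto simp: auto_def Bij_def bij_betw_def PiE_def)
qed (simp add: assms finite_PiE)

lemma finite_Epi:
  assumes "finite (carrier G)" "finite (carrier F)"
  shows "finite (Epi G F)"
proof (rule finite_subset)
  show "Epi G F \<subseteq> carrier G \<rightarrow>\<^sub>E carrier F"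
    by (auto simp: Epi_def epi_def PiE_def hom_def)
qed (simp add: assms finite_PiE)

definition decomposed_epis ::
    "('a, 'b) monoid_scheme \<Rightarrow> ('c, 'd) monoid_scheme \<Rightarrow> (('a \<Rightarrow> 'c) \<times> 'a set list) set" where
  "decomposed_epis G F = Sigma (Epi G F) (\<lambda>\<pi>. chief_decompositions G (kernel G F \<pi>))"

definition code_of ::
    "('a, 'b) monoid_scheme \<Rightarrow> ('a \<Rightarrow> 'c) \<times> 'a set list \<Rightarrow> (nat \<times> nat \<times> nat \<times> 'c) set list" where
  "code_of G = (\<lambda>(\<pi>, Rs). map (quotient_code G \<pi>) Rs)"

lemma code_of_eq_iso:
  assumes "finite_group G" "finite_group G'" "group F"
    and y: "y \<in> decomposed_epis G F" and y': "y' \<in> decomposed_epis G' F"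
    and eq: "code_of G y = code_of G' y'"
  shows "\<exists>\<alpha>\<in>iso G G' \<inter> extensional (carrier G).
           (\<forall>x\<in>carrier G. fst y' (\<alpha> x) = fst y x) \<and> snd y' = map ((`) \<alpha>) (snd y)"
proof -
  obtain \<pi> Rs \<pi>' Rs' where eqs: "y = (\<pi>, Rs)" "y' = (\<pi>', Rs')" by (cases y, cases y')
  show ?thesis
    using y y' eq chief_decomposition_rigid[OF assms(1) _ assms(2) _ assms(3), of \<pi> \<pi>' Rs Rs']
    unfolding eqs by (simp add: decomposed_epis_def Epi_def code_of_def)
qed

text \<open>All elements of the fibre arise from a single one by automorphisms of \<open>G\<close>: distinct elements
need distinct automorphisms, because the new epimorphism and the new list can be read off from
the automorphism and the old ones.\<close>

lemma card_code_fibre: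
  assumes G: "finite_group G" and F: "group F"
  shows "card {y \<in> decomposed_epis G F. code_of G y = ts} \<le> card (auto G)"
proof (cases "{y \<in> decomposed_epis G F. code_of G y = ts} = {}")
  case True
  show ?thesis unfolding True by simp
next
  case False
  let ?S = "{y \<in> decomposed_epis G F. code_of G y = ts}"
  obtain y0 where y0: "y0 \<in> ?S" using False unfolding ex_in_conv[symmetric] ..
  let ?P = "\<lambda>y \<alpha>. \<alpha> \<in> iso G G \<inter> extensional (carrier G) \<and>
    (\<forall>x\<in>carrier G. fst y (\<alpha> x) = fst y0 x) \<and> snd y = map ((`) \<alpha>) (snd y0)"
  have "\<exists>\<alpha>. ?P y \<alpha>" if y: "y \<in> ?S" for y
  proof -
    have "y0 \<in> decomposed_epis G F" "y \<in> decomposed_epis G F" "code_of G y0 = code_of G y"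
      using y0 y by simp_all
    from code_of_eq_iso[OF G G F this] show ?thesis unfolding Bex_def by (simp only: conj_assoc)
  qed
  then have "\<forall>y\<in>?S. \<exists>\<alpha>. ?P y \<alpha>" by (rule ballI)
  then obtain a where "\<forall>y\<in>?S. ?P y (a y)" unfolding bchoice_iff ..
  then have a: "?P y (a y)" if "y \<in> ?S" for y using that by (rule bspec)
  have "a ` ?S \<subseteq> auto G"
  proof
    fix \<alpha> assume "\<alpha> \<in> a ` ?S"
    then obtain y where y: "\<alpha> = a y" "y \<in> ?S" by (rule imageE)
    show "\<alpha> \<in> auto G" using a[OF y(2)] by (simp add: y(1) auto_def Bij_def iso_def)
  qed
  moreover have "inj_on a ?S"
  proof (rule inj_onI)
    fix y z assume yz: "y \<in> ?S" "z \<in> ?S" and eq: "a y = a z"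
    note y = a[OF yz(1)] and z = a[OF yz(2)]
    have "fst y = fst z"
    proof (rule extensionalityI)
      show "fst y \<in> extensional (carrier G)" "fst z \<in> extensional (carrier G)"
        using yz by (auto simp: decomposed_epis_def Epi_def)
      fix u assume "u \<in> carrier G"
      moreover have "a y ` carrier G = carrier G"
        using y by (simp add: iso_def bij_betw_def)
      ultimately obtain x where x: "x \<in> carrier G" "u = a y x" by blast
      then show "fst y u = fst z u" using y z eq by simp
    qed
    moreover have "snd y = snd z" using y z eq by simp
    ultimately show "y = z" by (rule prod_eqI)
  qed
  ultimately show ?thesis
    using finite_auto G by (intro card_inj_on_le) (auto simp: finite_group_def)
qed

text \<open>If \<open>R\<close> is maximal in \<open>K\<close>, then \<open>G / R\<close> is an extension of \<open>F\<close> by the chief factor \<open>K / R\<close>, so its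
order is at most \<open>order F * B\<close>.\<close>

lemma code_of_in_lists:
  assumes G: "finite_group G" "refinable B G" and F: "finite_group F" and y: "y \<in> decomposed_epis G F"
  shows "code_of G y \<in> lists (code_space (order F * B) (carrier F))"
    and "order G \<le> order F * B ^ length (code_of G y)"
proof -
  obtain \<pi> Rs where y': "y = (\<pi>, Rs)" by (cases y)
  have \<pi>: "\<pi> \<in> epi G F" and Rs: "Rs \<in> chief_decompositions G (kernel G F \<pi>)"
    using y by (auto simp: y' decomposed_epis_def Epi_def)
  have fin: "finite (carrier G)" using G(1) by (simp add: finite_group_def)
  interpret group_hom G F \<pi>
    using G F \<pi> by (simp add: finite_group_def group_hom_def group_hom_axioms_def epi_def)
  let ?K = "kernel G F \<pi>"
  have K: "?K \<lhd> G" by (rule normal_kernel)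
  have surj: "\<pi> ` carrier G = carrier F" using \<pi> by (simp add: epi_def)
  have "card (carrier G) = card (carrier F) * card (carrier G \<inter> ?K)"
    using card_subgroup_hom[OF G.subgroup_self fin] surj by simp
  also have "carrier G \<inter> ?K = ?K" by (auto simp: kernel_def)
  finally have ord: "order G = order F * card ?K" by (simp add: order_def)
  have irr: "irredundant (maximal_normals_below G ?K) ?K Rs" and one: "foldr (\<inter>) Rs ?K = {\<one>\<^bsub>G\<^esub>}"
    using Rs by (auto simp: chief_decompositions_def decompositions_def)
  have "card ?K \<le> B ^ length Rs"
    using G.card_le_power_length[OF fin G(2) K irr] one by simp
  then show "order G \<le> order F * B ^ length (code_of G y)"
    by (simp add: ord y' code_of_def)
  have "quotient_code G \<pi> R \<in> code_space (order F * B) (carrier F)"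
    if "R \<in> set Rs" for R
  proof (rule G.quotient_code_mem[OF fin])
    have Rmax: "R \<in> maximal_normals_below G ?K"
      using irredundant_distinct[OF irr] that by blast
    then have R: "R \<lhd> G" "R \<subset> ?K"
      by (auto simp: maximal_normals_below_def normals_below_def)
    obtain V where V: "V \<lhd> G" "R \<subset> V" "V \<subseteq> ?K" "card V \<le> B * card R"
      by (rule refinableD[OF G(2) R(1) K R(2)])
    then have "V = ?K"
      using Rmax unfolding maximal_normals_below_def normals_below_def by blast
    have "card (rcosets\<^bsub>G\<^esub> R) * card R = order G"
      using G.lagrange[OF normal_imp_subgroup[OF R(1)]] .
    also have "\<dots> \<le> order F * (B * card R)"
      unfolding ord using V(4) \<open>V = ?K\<close> by (intro mult_le_mono2) simp
    finally have "card (rcosets\<^bsub>G\<^esub> R) * card R \<le> order F * B * card R"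
      by (simp add: mult.assoc)
    moreover have "card R > 0"
    proof -
      have "\<one>\<^bsub>G\<^esub> \<in> R" "R \<subseteq> carrier G"
        using normal_imp_subgroup[OF R(1)] by (auto simp: subgroup.one_closed dest: subgroup.subset)
      then show ?thesis using finite_subset[OF _ fin] by (auto simp: card_gt_0_iff)
    qed
    ultimately show "card (rcosets\<^bsub>G\<^esub> R) \<le> order F * B" by simp
    show "\<pi> \<in> carrier G \<rightarrow> carrier F" by simp
  qed
  then show "code_of G y \<in> lists (code_space (order F * B) (carrier F))"
    by (auto simp only: y' code_of_def prod.case in_lists_conv_set set_map)
qed


section \<open>Convergence\<close>

lemma sum_lists_exp_le:
  fixes D :: real
  assumes T: "finite T" and U: "finite U" "U \<subseteq> lists T" and D: "D \<ge> 0"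
  shows "(\<Sum>ts\<in>U. D ^ length ts / fact (length ts)) \<le> exp (real (card T) * D)"
proof -
  let ?L = "\<lambda>n. {ts. set ts \<subseteq> T \<and> length ts = n}"
  let ?f = "\<lambda>n. (real (card T) * D) ^ n /\<^sub>R fact n"
  define N where "N = length ` U"
  have N: "finite N" using U(1) by (simp add: N_def)
  have "(\<Sum>ts\<in>U. D ^ length ts / fact (length ts))
      = (\<Sum>n\<in>N. \<Sum>ts | ts \<in> U \<and> length ts = n. D ^ length ts / fact (length ts))"
    unfolding N_def by (rule sum.image_gen[OF U(1)])
  also have "\<dots> \<le> (\<Sum>n\<in>N. ?f n)"
  proof (rule sum_mono)
    fix n
    have "(\<Sum>ts | ts \<in> U \<and> length ts = n. D ^ length ts / fact (length ts))
        = (\<Sum>ts | ts \<in> U \<and> length ts = n. D ^ n / fact n)"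
      by (intro sum.cong) auto
    also have "\<dots> = real (card {ts \<in> U. length ts = n}) * (D ^ n / fact n)" by simp
    also have "card {ts \<in> U. length ts = n} \<le> card T ^ n"
      unfolding card_lists_length_eq[OF T, symmetric]
      using U(2) by (intro card_mono finite_lists_length_eq T) auto
    then have "real (card {ts \<in> U. length ts = n}) * (D ^ n / fact n)
        \<le> real (card T ^ n) * (D ^ n / fact n)"
      using D by (intro mult_right_mono) simp_all
    also have "\<dots> = ?f n" by (simp add: power_mult_distrib divide_simps)
    finally show "(\<Sum>ts | ts \<in> U \<and> length ts = n. D ^ length ts / fact (length ts)) \<le> ?f n" .
  qed
  also have "\<dots> \<le> suminf ?f"
    using D by (intro sum_le_suminf N sums_summable[OF exp_converges]) simp
  also have "\<dots> = exp (real (card T) * D)"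
    by (rule sums_unique[OF exp_converges, symmetric])
  finally show ?thesis .
qed

text \<open>The bound for \<open>\<mu>\<close> spreads the term of \<open>\<pi>\<close> over the decompositions of its kernel. For each
of them the cube of \<open>Z\<close> is at most \<open>8 ^ \<ell>\<close>, and the \<open>k\<close>-th power of the order of \<open>G\<close> is at
most \<open>order F ^ k * (B ^ k) ^ \<ell>\<close>. Collecting decomposed epimorphisms with the same code cancels
the order of the automorphism group.\<close>

lemma sum_epis_le_sum_codes:
  fixes C D m :: real
  assumes G: "finite_group G" "refinable B G" and F: "finite_group F"
    and m: "0 \<le> m" "m \<le> C * real (order G) ^ k" and C: "C \<ge> 0"
  shows "(\<Sum>\<pi>\<in>Epi G F. \<bar>real_of_int (mu_epi G F \<pi>)\<bar> / real (card (auto G)) * real (Z_epi G F \<pi>) ^ 3 * m)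
    \<le> C * real (order F) ^ k
        * (\<Sum>ts\<in>code_of G ` decomposed_epis G F. (8 * real B ^ k) ^ length ts / fact (length ts))"
    (is "_ \<le> ?A * _")
proof -
  have fin: "finite (carrier G)" "finite (carrier F)" and gr: "group G" "group F"
    using G F by (auto simp: finite_group_def)
  let ?a = "real (card (auto G))"
  let ?g = "\<lambda>ts. (8 * real B ^ k) ^ length ts / fact (length ts) :: real"
  let ?Y = "decomposed_epis G F"
  have "(\<lambda>x\<in>carrier G. x) \<in> auto G" using gr(1) by (rule group.id_in_auto)
  then have a: "?a > 0"
    using finite_auto[OF fin(1)] by (auto simp: card_gt_0_iff)
  have finD: "finite (chief_decompositions G K)" for K
    using gr(1) fin(1) by (rule group.finite_chief_decompositions)
  have finY: "finite ?Y"
    unfolding decomposed_epis_def using finite_Epi[OF fin] finD by (intro finite_SigmaI)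
  have "\<bar>real_of_int (mu_epi G F \<pi>)\<bar> / ?a * real (Z_epi G F \<pi>) ^ 3 * m
      \<le> (\<Sum>Rs\<in>chief_decompositions G (kernel G F \<pi>). ?A / ?a * ?g (code_of G (\<pi>, Rs)))"
    if \<pi>: "\<pi> \<in> Epi G F" for \<pi>
  proof -
    let ?D = "chief_decompositions G (kernel G F \<pi>)"
    let ?z = "real (Z_epi G F \<pi>) ^ 3 * m / ?a"
    have epi: "\<pi> \<in> epi G F" using \<pi> by (simp add: Epi_def)
    have z: "?z \<ge> 0" using m(1) by simp
    have "\<bar>real_of_int (mu_epi G F \<pi>)\<bar> / ?a * real (Z_epi G F \<pi>) ^ 3 * m
        = \<bar>real_of_int (mu_epi G F \<pi>)\<bar> * ?z" by simp
    also have "\<dots> \<le> (\<Sum>Rs\<in>?D. 1 / fact (length Rs)) * ?z"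
      by (intro mult_right_mono abs_mu_epi_le[OF G(1) gr(2) epi] z)
    also have "\<dots> = (\<Sum>Rs\<in>?D. 1 / fact (length Rs) * ?z)" by (rule sum_distrib_right)
    also have "\<dots> \<le> (\<Sum>Rs\<in>?D. ?A / ?a * ?g (code_of G (\<pi>, Rs)))"
    proof (rule sum_mono)
      fix Rs assume Rs: "Rs \<in> ?D"
      let ?n = "length Rs"
      have y: "(\<pi>, Rs) \<in> ?Y" using \<pi> Rs by (simp add: decomposed_epis_def)
      have len: "length (code_of G (\<pi>, Rs)) = ?n" by (simp add: code_of_def)
      have "real (Z_epi G F \<pi>) \<le> 2 ^ ?n"
        using Z_epi_le[OF G(1) gr(2) epi Rs] by (metis of_nat_le_iff of_nat_numeral of_nat_power)
      then have "real (Z_epi G F \<pi>) ^ 3 \<le> (2 ^ ?n) ^ 3" by (intro power_mono) simp_all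
      also have "(2 ^ ?n) ^ 3 = ((2::real) ^ 3) ^ ?n"
        by (simp only: power_mult[symmetric] mult.commute[of ?n])
      also have "\<dots> = 8 ^ ?n" by simp
      finally have Z: "real (Z_epi G F \<pi>) ^ 3 \<le> 8 ^ ?n" .
      have "real (order G) \<le> real (order F * B ^ ?n)"
        using code_of_in_lists(2)[OF G F y] len by (intro of_nat_mono) simp
      then have "real (order G) ^ k \<le> real (order F * B ^ ?n) ^ k" by (intro power_mono) simp_all
      then have "C * real (order G) ^ k \<le> C * real (order F * B ^ ?n) ^ k"
        using C by (rule mult_left_mono)
      with m(2) have "m \<le> C * real (order F * B ^ ?n) ^ k" by (rule order_trans)
      also have "\<dots> = ?A * (real B ^ k) ^ ?n"
        by (simp add: power_mult_distrib mult.commute flip: power_mult)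
      finally have "real (Z_epi G F \<pi>) ^ 3 * m \<le> 8 ^ ?n * (?A * (real B ^ k) ^ ?n)"
        using Z m(1) by (intro mult_mono) simp_all
      also have "\<dots> = ?A * (8 * real B ^ k) ^ ?n" by (simp add: power_mult_distrib)
      finally have "?z \<le> ?A * (8 * real B ^ k) ^ ?n / ?a"
        using a by (intro divide_right_mono) simp_all
      then have "1 / fact ?n * ?z \<le> 1 / fact ?n * (?A * (8 * real B ^ k) ^ ?n / ?a)"
        by (intro mult_left_mono) simp_all
      then show "1 / fact ?n * ?z \<le> ?A / ?a * ?g (code_of G (\<pi>, Rs))"
        unfolding len by (simp add: ac_simps)
    qed
    finally show ?thesis .
  qed
  then have "(\<Sum>\<pi>\<in>Epi G F. \<bar>real_of_int (mu_epi G F \<pi>)\<bar> / ?a * real (Z_epi G F \<pi>) ^ 3 * m)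
      \<le> (\<Sum>\<pi>\<in>Epi G F. \<Sum>Rs\<in>chief_decompositions G (kernel G F \<pi>). ?A / ?a * ?g (code_of G (\<pi>, Rs)))"
    by (rule sum_mono)
  also have "\<dots> = (\<Sum>y\<in>?Y. ?A / ?a * ?g (code_of G y))"
    unfolding decomposed_epis_def using finite_Epi[OF fin] finD
    by (subst sum.Sigma) (auto simp: case_prod_beta)
  also have "\<dots> = (\<Sum>ts\<in>code_of G ` ?Y. \<Sum>y | y \<in> ?Y \<and> code_of G y = ts. ?A / ?a * ?g (code_of G y))"
    by (rule sum.image_gen[OF finY])
  also have "\<dots> \<le> (\<Sum>ts\<in>code_of G ` ?Y. ?A * ?g ts)"
  proof (rule sum_mono)
    fix ts
    have "(\<Sum>y | y \<in> ?Y \<and> code_of G y = ts. ?A / ?a * ?g (code_of G y))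
        = (\<Sum>y | y \<in> ?Y \<and> code_of G y = ts. ?A / ?a * ?g ts)"
      by (intro sum.cong) auto
    also have "\<dots> = real (card {y \<in> ?Y. code_of G y = ts}) * (?A / ?a * ?g ts)" by simp
    also have "\<dots> \<le> ?a * (?A / ?a * ?g ts)"
      using card_code_fibre[OF G(1) gr(2), of ts] C a
      by (intro mult_right_mono) simp_all
    also have "\<dots> = ?A * ?g ts" using a by simp
    finally show "(\<Sum>y | y \<in> ?Y \<and> code_of G y = ts. ?A / ?a * ?g (code_of G y)) \<le> ?A * ?g ts" .
  qed
  also have "\<dots> = ?A * (\<Sum>ts\<in>code_of G ` ?Y. ?g ts)" by (rule sum_distrib_left[symmetric])
  finally show ?thesis .
qed

text \<open>Distinct isomorphism classes have disjoint sets of codes, so any partial sum is bounded by one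
sum over lists of codes, independently of the number of classes in it.\<close>

theorem corollary6p13:
  fixes M :: "nat monoid set \<Rightarrow> real"
    and n :: real
  assumes "\<exists>c::real. \<forall>G :: nat monoid. finite_group G \<longrightarrow>
             \<bar>M (iso_class G)\<bar> \<le> c * real (order G) powr n"
  shows "well_behaved M"
  unfolding well_behaved_def
proof (intro allI impI)
  fix \<L> F assume L: "is_level \<L>" and F: "finite_group (F :: nat monoid)"
  obtain c where c: "\<And>G :: nat monoid. finite_group G \<Longrightarrow>
      \<bar>M (iso_class G)\<bar> \<le> c * real (order G) powr n"
    using assms by blast
  obtain S where S: "finite S" "S \<subseteq> iso_classes" "\<L> = generated_level S"
    using L unfolding is_level_def by blast
  obtain B where B: "\<And>\<C>. \<C> \<in> \<L> \<Longrightarrow> \<C> \<in> iso_classes"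
      "\<And>\<C> G. \<C> \<in> \<L> \<Longrightarrow> G \<in> \<C> \<Longrightarrow> refinable B G"
    using generated_level_refinable[OF S(1,2)] unfolding S(3) by blast
  define k where "k = nat \<lceil>n\<rceil>"
  have M: "\<bar>M (iso_class G)\<bar> \<le> \<bar>c\<bar> * real (order G) ^ k"
    if G: "finite_group G" for G :: "nat monoid"
  proof -
    interpret group G using G by (simp add: finite_group_def)
    have "order G > 0"
      using G one_closed by (auto simp: order_def finite_group_def card_gt_0_iff)
    then have ord: "real (order G) \<ge> 1" by simp
    have "n \<le> real k" unfolding k_def by linarith
    then have "real (order G) powr n \<le> real (order G) powr real k"
      using ord by (rule powr_mono)
    also have "\<dots> = real (order G) ^ k" using ord by (intro powr_realpow) simp
    finally have "c * real (order G) powr n \<le> \<bar>c\<bar> * real (order G) ^ k"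
      by (intro mult_mono) simp_all
    with c[OF G] show ?thesis by linarith
  qed
  let ?G = representative
  let ?T = "code_space (order F * B) (carrier F)"
  let ?D = "8 * real B ^ k"
  let ?A = "\<bar>c\<bar> * real (order F) ^ k"
  let ?g = "\<lambda>ts. ?D ^ length ts / fact (length ts) :: real"
  let ?codes = "\<lambda>\<C>. code_of (?G \<C>) ` decomposed_epis (?G \<C>) F"
  let ?w = "\<lambda>\<C>. \<Sum>\<pi>\<in>Epi (?G \<C>) F. \<bar>real_of_int (mu_epi (?G \<C>) F \<pi>)\<bar> / real (card (auto (?G \<C>)))
      * real (Z_epi (?G \<C>) F \<pi>) ^ 3 * \<bar>M \<C>\<bar>"
  have G: "finite_group (?G \<C>)" "\<C> = iso_class (?G \<C>)" "refinable B (?G \<C>)" if "\<C> \<in> \<L>" for \<C>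
    using representative_iso_classes[OF B(1)[OF that]] B(2)[OF that representative_mem[OF B(1)[OF that]]]
    by auto
  have grF: "group F" and finF: "finite (carrier F)" using F by (auto simp: finite_group_def)
  have finT: "finite ?T" using finF by simp
  have w: "?w \<C> \<le> ?A * (\<Sum>ts\<in>?codes \<C>. ?g ts)" if C: "\<C> \<in> \<L>" for \<C>
    using M[OF G(1)[OF C]] G(2)[OF C]
    by (intro sum_epis_le_sum_codes[OF G(1)[OF C] G(3)[OF C] F]) simp_all
  have fin_codes: "finite (?codes \<C>)" if C: "\<C> \<in> \<L>" for \<C>
  proof -
    have "group (?G \<C>)" "finite (carrier (?G \<C>))" using G(1)[OF C] by (auto simp: finite_group_def)
    then have "finite (decomposed_epis (?G \<C>) F)"
      unfolding decomposed_epis_def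
      by (intro finite_SigmaI finite_Epi finF group.finite_chief_decompositions)
    then show ?thesis by (rule finite_imageI)
  qed
  have disjoint: "?codes \<C> \<inter> ?codes \<C>' = {}" if C: "\<C> \<in> \<L>" "\<C>' \<in> \<L>" "\<C> \<noteq> \<C>'" for \<C> \<C>'
  proof (rule ccontr)
    assume "?codes \<C> \<inter> ?codes \<C>' \<noteq> {}"
    then obtain y y' where "y \<in> decomposed_epis (?G \<C>) F" "y' \<in> decomposed_epis (?G \<C>') F"
        "code_of (?G \<C>) y = code_of (?G \<C>') y'" by auto
    from code_of_eq_iso[OF G(1)[OF C(1)] G(1)[OF C(2)] grF this]
    have "?G \<C> \<cong> ?G \<C>'" by (auto simp: is_iso_def)
    then have "?G \<C> \<in> iso_class (?G \<C>')"
      using G(1)[OF C(1)] by (simp add: iso_class_def)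
    then have "iso_class (?G \<C>) = iso_class (?G \<C>')"
      by (rule iso_class_eq[OF _ G(1)[OF C(2)]])
    with G(2)[OF C(1)] G(2)[OF C(2)] C(3) show False by simp
  qed
  have "?w summable_on \<L>"
  proof (rule nonneg_bdd_above_summable_on)
    show "?w \<C> \<ge> 0" for \<C> by (intro sum_nonneg) simp
    show "bdd_above (sum ?w ` {\<T>. \<T> \<subseteq> \<L> \<and> finite \<T>})"
    proof (rule bdd_aboveI2)
      fix \<T> assume "\<T> \<in> {\<T>. \<T> \<subseteq> \<L> \<and> finite \<T>}"
      then have T: "\<T> \<subseteq> \<L>" "finite \<T>" by simp_all
      have "sum ?w \<T> \<le> (\<Sum>\<C>\<in>\<T>. ?A * (\<Sum>ts\<in>?codes \<C>. ?g ts))"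
        using T(1) by (intro sum_mono w) blast
      also have "\<dots> = ?A * (\<Sum>\<C>\<in>\<T>. \<Sum>ts\<in>?codes \<C>. ?g ts)"
        by (rule sum_distrib_left[symmetric])
      also have "(\<Sum>\<C>\<in>\<T>. \<Sum>ts\<in>?codes \<C>. ?g ts) = (\<Sum>ts\<in>(\<Union>\<C>\<in>\<T>. ?codes \<C>). ?g ts)"
        using T fin_codes disjoint by (intro sum.UNION_disjoint[symmetric]) blast+
      also have "?A * \<dots> \<le> ?A * exp (real (card ?T) * ?D)"
      proof (intro mult_left_mono sum_lists_exp_le finT)
        show "finite (\<Union>\<C>\<in>\<T>. ?codes \<C>)" using T fin_codes by blast
        show "(\<Union>\<C>\<in>\<T>. ?codes \<C>) \<subseteq> lists ?T"
        proof (rule UN_least, rule image_subsetI)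
          fix \<C> y assume "\<C> \<in> \<T>" and y: "y \<in> decomposed_epis (?G \<C>) F"
          then have C: "\<C> \<in> \<L>" using T(1) by blast
          show "code_of (?G \<C>) y \<in> lists ?T"
            using code_of_in_lists(1)[OF G(1)[OF C] G(3)[OF C] F y] .
        qed
      qed simp_all
      finally show "sum ?w \<T> \<le> ?A * exp (real (card ?T) * ?D)" .
    qed
  qed
  then show "(\<lambda>\<C>. let G = ?G \<C> in \<Sum>\<pi>\<in>Epi G F. \<bar>real_of_int (mu_epi G F \<pi>)\<bar> / real (card (auto G))
      * real (Z_epi G F \<pi>) ^ 3 * \<bar>M \<C>\<bar>) summable_on \<L>"
    by (simp only: Let_def)
qed

end
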